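(* Let $\hat u_{\mathcal{A}}\in\mathbb{R}^{PN}$ be a fixed point of the spectral inverse iteration in tensor form and $(\hat s,\hat v)\in\mathbb{R}^P\times\mathbb{R}^{PN}$ a corresponding pair, i.e. $\hat u_{\mathcal{A}}=\mathbf{S}\hat v$, $\hat v=\mathbf{T}(\hat s)\mathbf{S}\hat v$ and $F(\hat s,\hat v)=0$. Assume that $\Delta(\hat s)$ is invertible. Let $\hat\mu_{\mathcal{A}}=\Delta^{-1}(\hat s)\hat e_1$, where $\hat e_1=\{\delta_{\alpha0}\}_{\alpha\in\mathcal{A}}\in\mathbb{R}^P$. Set $$\phi_{\min}:=\|\Delta^{-1}(\hat s)\|_{\mathbb{R}^P}^{-1},\qquad \psi_{\max}:=\|\mathbf{R}(\hat s,\hat v)\mathbf{S}^{-1}\|_{\mathbb{R}^P\otimes\mathbb{R}^N_M}.$$ Then the iterates of the spectral inverse iteration in tensor form satisfy $$\|\hat u^{(k)}-\hat u_{\mathcal{A}}\|_{\mathbb{R}^P\otimes\mathbb{R}^N_M}\le\frac{\psi_{\max}}{\phi_{\min}}\|\hat u^{(k-1)}-\hat u_{\mathcal{A}}\|_{\mathbb{R}^P\otimes\mathbb{R}^N_M},\qquad k\in\mathbb{N},$$ for $\hat u^{(k)}$ sufficiently close to $\hat u_{\mathcal{A}}$. Furthermore, there exists $C>0$ such that $$\|\hat\mu^{(k)}-\hat\mu_{\mathcal{A}}\|_{\mathbb{R}^P}\le C\|\hat u^{(k)}-\hat u_{\mathcal{A}}\|_{\mathbb{R}^P\otimes\mathbb{R}^N_M},\qquad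 k\in\mathbb{N}.$$
   Context: Parameter space: $\Gamma=[-1,1]^\infty$ with points $y=(y_1,y_2,\dots)$ and the uniform product probability measure $\nu$; $\mathbb{E}[f]=\int_\Gamma f\,d\nu$. Matrices: $D\subset\mathbb{R}^d$ is a bounded convex domain with sufficiently smooth boundary, $a_0,a_1,a_2,\dots\in L^\infty(D)$ satisfy $\operatorname{ess\,inf}_{x\in D}a_0(x)>\sum_{m\ge1}\|a_m\|_{L^\infty(D)}$, and $V_h=\operatorname{span}\{\varphi_1,\dots,\varphi_N\}\subset H^1_0(D)$ is an $N$-dimensional finite element space. Put $K^{(m)}_{ij}=\int_D a_m\nabla\varphi_i\cdot\nabla\varphi_j\,dx$ for $m\ge0$ and $M_{ij}=\int_D\varphi_i\varphi_j\,dx$. Thus $M$ and every $K(y)=K^{(0)}+\sum_{m\ge1}y_mK^{(m)}$, $y\in\Gamma$, are symmetric positive definite. Polynomials: for a finitely supported multi-index $\alpha\in\mathbb{N}_0^\infty$ let $\Lambda_\alpha(y)=\prod_{m:\alpha_m\ne0}L_{\alpha_m}(y_m)$, where $L_p$ is the univariate Legendre polynomial of degree $p$, normalized so that $\mathbb{E}[\Lambda_\alpha^2]=1$. Fix a finite set $\mathcal{A}$ of such multi-indices, $P=\#\mathcal{A}$. Define $P\times P$ matrices (rows and columns indexed by $\mathcal{A}$) by $[G^{(\alpha)}]_{\beta\gamma}=\mathbb{E}[\Lambda_\alpha\Lambda_\beta\Lambda_\gamma]$ for $\alpha\in\mathcal{A}$, $[G^{(m)}]_{\alpha\beta}=\mathbb{E}[y_m\Lambda_\alpha\Lambda_\beta]$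 for integers $m\ge1$, and $G^{(0)}=I_P$ for the integer $m=0$. Tensor objects: vectors in $\mathbb{R}^{PN}=\mathbb{R}^P\otimes\mathbb{R}^N$ are arrays $\hat v=\{v_{\alpha i}\}_{\alpha\in\mathcal{A},1\le i\le N}$. Let $M(\mathcal{A})$ be the largest $m\in\mathbb{N}$ for which some $\alpha\in\mathcal{A}$ has $\alpha_m\neq0$, and for $\hat s=\{s_\alpha\}\in\mathbb{R}^P$ and $\hat v,\hat w\in\mathbb{R}^{PN}$ set $$\Delta(\hat s)=\sum_{\alpha\in\mathcal{A}}s_\alpha G^{(\alpha)},\quad \widehat{\mathbf{K}}=\sum_{m=0}^{M(\mathcal{A})}G^{(m)}\otimes K^{(m)},\quad \widehat{\mathbf{M}}=I_P\otimes M,\quad \mathbf{S}=\widehat{\mathbf{M}}^{-1}\widehat{\mathbf{K}},\quad \mathbf{T}(\hat s)=\Delta(\hat s)\otimes I_N,$$ $$F_\alpha(\hat s,\hat v)=\hat s\cdot G^{(\alpha)}\hat s-\hat v\cdot(G^{(\alpha)}\otimes M)\hat v,\qquad F^v_\alpha(\hat v,\hat w)=\hat v\cdot(G^{(\alpha)}\otimes M)\hat w\qquad(\alpha\in\mathcal{A}),$$ so $F$ and $F^v$ take values in $\mathbb{R}^P$. The linear operator $\mathbf{R}(\hat s,\hat v):\mathbb{R}^{PN}\to\mathbb{R}^{PN}$ is defined by $$\mathbf{R}(\hat s,\hat v)\hat w=\hat w-\mathbf{T}\big(\Delta^{-1}(\hat s)F^v(\hat v,\hat w)\big)\mathbf{T}^{-1}(\hat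 s)\hat v.$$ Norms: $\|\cdot\|_{\mathbb{R}^P}$ is the Euclidean norm and $\|\hat v\|^2_{\mathbb{R}^P\otimes\mathbb{R}^N_M}=\sum_{\alpha\in\mathcal{A}}\sum_{i,j}v_{\alpha i}M_{ij}v_{\alpha j}$; for matrices these denote the induced operator norms. Spectral inverse iteration in tensor form: starting from an initial guess $\hat u^{(0)}\in\mathbb{R}^{PN}$, for $k=1,2,\dots$: (1) solve $\hat v^{[k]}\in\mathbb{R}^{PN}$ from $\widehat{\mathbf{K}}\hat v^{[k]}=\widehat{\mathbf{M}}\hat u^{(k-1)}$; (2) solve $\hat s^{[k]}\in\mathbb{R}^P$ from the nonlinear system $F(\hat s^{[k]},\hat v^{[k]})=0$ (for instance by Newton's method) with the initial guess $s_\alpha=\|\hat v^{[k]}\|_{\mathbb{R}^P\otimes\mathbb{R}^N_M}\delta_{\alpha0}$, $\alpha\in\mathcal{A}$; (3) solve $\hat u^{(k)}\in\mathbb{R}^{PN}$ from $\mathbf{T}(\hat s^{[k]})\hat u^{(k)}=\hat v^{[k]}$; (4) stop if $\|\hat u^{(k)}-\hat u^{(k-1)}\|_{\mathbb{R}^P\otimes\mathbb{R}^N_M}$ is below a prescribed tolerance. The associated eigenvalue approximation $\hat\mu^{(k)}\in\mathbb{R}^P$ is the solution of $\Delta(\hat s^{[k]})\hat\mu^{(k)}=\hat e_1$.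
   Formalization: As stated both bounds can fail. Proved instead, for u^(k) near u_A and s^[k] near ŝ: the first bound with an added term c‖u^(k-1)-u_A‖², and the eigenvalue bound with ‖u^(k-1)-u_A‖ in place of ‖u^(k)-u_A‖. *)

theory Defs
  imports "HOL-Probability.Probability"
begin

section \<open>Function spaces on a domain of $\mathbb{R}^d$\<close>

fun Ck_on :: "nat \<Rightarrow> 'a::euclidean_space set \<Rightarrow> ('a \<Rightarrow> real) \<Rightarrow> bool" where
  "Ck_on 0 U f \<longleftrightarrow> continuous_on U f"
| "Ck_on (Suc k) U f \<longleftrightarrow> (\<forall>x\<in>U. f differentiable (at x)) \<and>
     (\<forall>b\<in>Basis. Ck_on k U (\<lambda>x. frechet_derivative f (at x) b))"

definition classical_grad :: "('a::euclidean_space \<Rightarrow> real) \<Rightarrow> 'a \<Rightarrow> 'a" where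
  "classical_grad f x = (\<Sum>b\<in>Basis. frechet_derivative f (at x) b *\<^sub>R b)"

definition Ck_boundary :: "nat \<Rightarrow> 'a::euclidean_space set \<Rightarrow> bool" where
  "Ck_boundary k D \<longleftrightarrow> (\<forall>x\<in>frontier D. \<exists>U g. open U \<and> x \<in> U \<and> Ck_on k U g \<and>
     (\<forall>y\<in>U. classical_grad g y \<noteq> 0) \<and> D \<inter> U = {y \<in> U. g y < 0})"

definition test_function :: "'a::euclidean_space set \<Rightarrow> ('a \<Rightarrow> real) \<Rightarrow> bool" where
  "test_function D f \<longleftrightarrow> (\<forall>k. Ck_on k UNIV f) \<and>
     (\<exists>C. compact C \<and> C \<subseteq> D \<and> (\<forall>x. x \<notin> C \<longrightarrow> f x = 0))"

definition L2_on :: "'a::euclidean_space set \<Rightarrow> ('a \<Rightarrow> 'b::euclidean_space) \<Rightarrow> bool" where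
  "L2_on D f \<longleftrightarrow> f \<in> borel_measurable (lebesgue_on D) \<and>
     integrable (lebesgue_on D) (\<lambda>x. (norm (f x))\<^sup>2)"

definition has_weak_grad ::
  "'a::euclidean_space set \<Rightarrow> ('a \<Rightarrow> real) \<Rightarrow> ('a \<Rightarrow> 'a) \<Rightarrow> bool" where
  "has_weak_grad D f g \<longleftrightarrow> L2_on D f \<and> L2_on D g \<and>
     (\<forall>\<psi>. test_function D \<psi> \<longrightarrow> (\<forall>b\<in>Basis.
        (LINT x|lebesgue_on D. f x * frechet_derivative \<psi> (at x) b) =
        - (LINT x|lebesgue_on D. (g x \<bullet> b) * \<psi> x)))"

definition weak_grad :: "'a::euclidean_space set \<Rightarrow> ('a \<Rightarrow> real) \<Rightarrow> 'a \<Rightarrow> 'a" where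
  "weak_grad D f = (SOME g. has_weak_grad D f g)"

text \<open>The space $H^1_0(D)$: the closure of the test functions in the $H^1(D)$ norm.\<close>

definition H10 :: "'a::euclidean_space set \<Rightarrow> ('a \<Rightarrow> real) set" where
  "H10 D = {f. has_weak_grad D f (weak_grad D f) \<and>
     (\<exists>\<psi>. (\<forall>n::nat. test_function D (\<psi> n)) \<and>
       (\<lambda>n. LINT x|lebesgue_on D. (\<psi> n x - f x)\<^sup>2) \<longlonglongrightarrow> 0 \<and>
       (\<lambda>n. LINT x|lebesgue_on D. (norm (classical_grad (\<psi> n) x - weak_grad D f x))\<^sup>2)
          \<longlonglongrightarrow> 0)}"

definition Linfty_norm :: "'a::euclidean_space set \<Rightarrow> ('a \<Rightarrow> real) \<Rightarrow> ereal" where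
  "Linfty_norm D f = esssup (lebesgue_on D) (\<lambda>x. ereal \<bar>f x\<bar>)"

definition Linfty_on :: "'a::euclidean_space set \<Rightarrow> ('a \<Rightarrow> real) \<Rightarrow> bool" where
  "Linfty_on D f \<longleftrightarrow> f \<in> borel_measurable (lebesgue_on D) \<and> Linfty_norm D f < \<infinity>"

definition ess_inf_on :: "'a::euclidean_space set \<Rightarrow> ('a \<Rightarrow> real) \<Rightarrow> ereal" where
  "ess_inf_on D f = - esssup (lebesgue_on D) (\<lambda>x. ereal (- f x))"


section \<open>Finite element matrices\<close>

text \<open>Linear independence is that of the classes in $L^2(D)$.\<close>

definition fe_basis :: "'a::euclidean_space set \<Rightarrow> ('n::finite \<Rightarrow> 'a \<Rightarrow> real) \<Rightarrow> bool" where
  "fe_basis D \<phi> \<longleftrightarrow> (\<forall>i. \<phi> i \<in> H10 D) \<and>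
     (\<forall>c :: 'n \<Rightarrow> real. (AE x in lebesgue_on D. (\<Sum>i\<in>UNIV. c i * \<phi> i x) = 0) \<longrightarrow> (\<forall>i. c i = 0))"

definition stiffness_matrix ::
  "'a::euclidean_space set \<Rightarrow> ('n::finite \<Rightarrow> 'a \<Rightarrow> real) \<Rightarrow> ('a \<Rightarrow> real) \<Rightarrow> real^'n^'n" where
  "stiffness_matrix D \<phi> a =
     (\<chi> i j. LINT x|lebesgue_on D. a x * (weak_grad D (\<phi> i) x \<bullet> weak_grad D (\<phi> j) x))"

definition mass_matrix ::
  "'a::euclidean_space set \<Rightarrow> ('n::finite \<Rightarrow> 'a \<Rightarrow> real) \<Rightarrow> real^'n^'n" where
  "mass_matrix D \<phi> = (\<chi> i j. LINT x|lebesgue_on D. \<phi> i x * \<phi> j x)"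


section \<open>Parameter space and Legendre chaos\<close>

text \<open>The parameters are numbered $y_1, y_2, \dots$, so the index set of the product is
  \<open>{1..}\<close>. Each factor lives on the whole real line but is concentrated on $[-1,1]$.\<close>

definition param_measure :: "(nat \<Rightarrow> real) measure" where
  "param_measure = PiM {1..} (\<lambda>_. uniform_measure lborel {-1..1})"

abbreviation param_expectation :: "((nat \<Rightarrow> real) \<Rightarrow> real) \<Rightarrow> real" where
  "param_expectation f \<equiv> (LINT y|param_measure. f y)"

text \<open>Rodrigues' formula.\<close>

definition legendre :: "nat \<Rightarrow> real poly" where
  "legendre p = smult (1 / (2 ^ p * fact p)) ((pderiv ^^ p) ([:-1, 0, 1:] ^ p))"

definition legendre_normalized :: "nat \<Rightarrow> real poly" where
  "legendre_normalized p =
     smult (1 / sqrt (LINT t|uniform_measure lborel {-1..1}. (poly (legendre p) t)\<^sup>2)) (legendre p)"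

definition multi_index :: "(nat \<Rightarrow> nat) \<Rightarrow> bool" where
  "multi_index \<alpha> \<longleftrightarrow> finite {m. \<alpha> m \<noteq> 0} \<and> \<alpha> 0 = 0"

definition chaos_poly :: "(nat \<Rightarrow> nat) \<Rightarrow> (nat \<Rightarrow> real) \<Rightarrow> real" where
  "chaos_poly \<alpha> y = (\<Prod>m\<in>{m. \<alpha> m \<noteq> 0}. poly (legendre_normalized (\<alpha> m)) (y m))"

text \<open>A finite set of $P$ multi-indices is given by an injective enumeration \<open>A\<close> whose index type
  \<open>'p\<close> has $P$ elements.\<close>

definition G_triple :: "('p::finite \<Rightarrow> nat \<Rightarrow> nat) \<Rightarrow> 'p \<Rightarrow> real^'p^'p" where
  "G_triple A p = (\<chi> q r. param_expectation
     (\<lambda>y. chaos_poly (A p) y * chaos_poly (A q) y * chaos_poly (A r) y))"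

definition G_moment :: "('p::finite \<Rightarrow> nat \<Rightarrow> nat) \<Rightarrow> nat \<Rightarrow> real^'p^'p" where
  "G_moment A m = (if m = 0 then mat 1
     else (\<chi> q r. param_expectation (\<lambda>y. y m * chaos_poly (A q) y * chaos_poly (A r) y)))"

text \<open>For the set consisting of the zero multi-index only, the value is \<open>0\<close>.\<close>

definition max_active :: "('p::finite \<Rightarrow> nat \<Rightarrow> nat) \<Rightarrow> nat" where
  "max_active A = Max (insert 0 {m. \<exists>p. A p m \<noteq> 0})"


section \<open>Tensor objects\<close>

definition kron :: "real^'p^'p \<Rightarrow> real^'n^'n \<Rightarrow> real^('p \<times> 'n)^('p \<times> 'n)"  (infixr "\<otimes>\<^sub>K" 72) where
  "X \<otimes>\<^sub>K Y = (\<chi> a b. X $ fst a $ fst b * Y $ snd a $ snd b)"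

definition Delta :: "('p::finite \<Rightarrow> nat \<Rightarrow> nat) \<Rightarrow> real^'p \<Rightarrow> real^'p^'p" where
  "Delta A s = (\<Sum>p\<in>UNIV. s $ p *\<^sub>R G_triple A p)"

definition K_hat :: "('p::finite \<Rightarrow> nat \<Rightarrow> nat) \<Rightarrow> (nat \<Rightarrow> real^'n::finite^'n)
    \<Rightarrow> real^('p \<times> 'n)^('p \<times> 'n)" where
  "K_hat A K = (\<Sum>m\<le>max_active A. G_moment A m \<otimes>\<^sub>K K m)"

definition M_hat :: "real^'n::finite^'n \<Rightarrow> real^('p::finite \<times> 'n)^('p \<times> 'n)" where
  "M_hat M = mat 1 \<otimes>\<^sub>K M"

definition S_mat :: "('p::finite \<Rightarrow> nat \<Rightarrow> nat) \<Rightarrow> (nat \<Rightarrow> real^'n::finite^'n) \<Rightarrow> real^'n^'n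
    \<Rightarrow> real^('p \<times> 'n)^('p \<times> 'n)" where
  "S_mat A K M = matrix_inv (M_hat M) ** K_hat A K"

definition T_mat :: "('p::finite \<Rightarrow> nat \<Rightarrow> nat) \<Rightarrow> real^'p \<Rightarrow> real^('p \<times> 'n::finite)^('p \<times> 'n)" where
  "T_mat A s = Delta A s \<otimes>\<^sub>K mat 1"

definition F_fun :: "('p::finite \<Rightarrow> nat \<Rightarrow> nat) \<Rightarrow> real^'n::finite^'n
    \<Rightarrow> real^'p \<Rightarrow> real^('p \<times> 'n) \<Rightarrow> real^'p" where
  "F_fun A M s v = (\<chi> p. s \<bullet> (G_triple A p *v s) - v \<bullet> ((G_triple A p \<otimes>\<^sub>K M) *v v))"

definition Fv_fun :: "('p::finite \<Rightarrow> nat \<Rightarrow> nat) \<Rightarrow> real^'n::finite^'n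
    \<Rightarrow> real^('p \<times> 'n) \<Rightarrow> real^('p \<times> 'n) \<Rightarrow> real^'p" where
  "Fv_fun A M v w = (\<chi> p. v \<bullet> ((G_triple A p \<otimes>\<^sub>K M) *v w))"

definition R_op :: "('p::finite \<Rightarrow> nat \<Rightarrow> nat) \<Rightarrow> real^'n::finite^'n
    \<Rightarrow> real^'p \<Rightarrow> real^('p \<times> 'n) \<Rightarrow> real^('p \<times> 'n) \<Rightarrow> real^('p \<times> 'n)" where
  "R_op A M s v w =
     w - T_mat A (matrix_inv (Delta A s) *v Fv_fun A M v w) *v (matrix_inv (T_mat A s) *v v)"

definition e1_vec :: "('p::finite \<Rightarrow> nat \<Rightarrow> nat) \<Rightarrow> real^'p" where
  "e1_vec A = (\<chi> p. if A p = (\<lambda>_. 0) then 1 else 0)"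

definition M_norm :: "real^'n::finite^'n \<Rightarrow> real^('p::finite \<times> 'n) \<Rightarrow> real" where
  "M_norm M v = sqrt (\<Sum>p\<in>UNIV. \<Sum>i\<in>UNIV. \<Sum>j\<in>UNIV. v $ (p, i) * M $ i $ j * v $ (p, j))"

definition M_onorm :: "real^'n::finite^'n
    \<Rightarrow> (real^('p::finite \<times> 'n) \<Rightarrow> real^('p \<times> 'n)) \<Rightarrow> real" where
  "M_onorm M f = (SUP w. M_norm M (f w) / M_norm M w)"


section \<open>Spectral inverse iteration in tensor form\<close>

text \<open>The first \<open>n\<close> steps of the iteration. The nonlinear system for \<open>s k\<close> determines a root only
  up to the choice made by the solver, hence a predicate rather than a function. An infinite run
  is one that satisfies the predicate for every \<open>n\<close>.\<close>

definition spectral_inverse_iteration :: "('p::finite \<Rightarrow> nat \<Rightarrow> nat)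
    \<Rightarrow> (nat \<Rightarrow> real^'n::finite^'n) \<Rightarrow> real^'n^'n \<Rightarrow> nat
    \<Rightarrow> (nat \<Rightarrow> real^('p \<times> 'n)) \<Rightarrow> (nat \<Rightarrow> real^('p \<times> 'n)) \<Rightarrow> (nat \<Rightarrow> real^'p) \<Rightarrow> bool" where
  "spectral_inverse_iteration A K M n u v s \<longleftrightarrow> (\<forall>k\<in>{1..n}.
     K_hat A K *v v k = M_hat M *v u (k - 1) \<and>
     F_fun A M (s k) (v k) = 0 \<and>
     T_mat A (s k) *v u k = v k)"

end

theory Submission
  imports Defs
begin

text \<open>Write \<open>d = s - s\<^sub>0\<close>, \<open>w = v - v\<^sub>0\<close>, \<open>e = u - u\<^sub>0\<close> for the deviations from the fixed point.
  Since \<open>\<Delta>(s)t\<close> is symmetric bilinear in \<open>(s, t)\<close>, the equation \<open>F(s, v) = 0\<close> reads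
  \<open>\<Delta>(s)s = F\<^sup>v(v, v)\<close>; expanding it and \<open>T(s)u = v\<close> at the fixed point gives
  \<open>d = \<Delta>\<^sup>-\<^sup>1(s\<^sub>0) F\<^sup>v(v\<^sub>0, w) + O(w\<^sup>2)\<close> and \<open>e = T\<^sup>-\<^sup>1(s\<^sub>0) R(s\<^sub>0, v\<^sub>0) w + O(w\<^sup>2)\<close>,
  where \<open>w\<close> is \<open>S\<^sup>-\<^sup>1\<close> applied to the previous error. Smallness of \<open>w\<close> itself
  need not be assumed: it is bounded because \<open>v = T(s)u\<close> with \<open>s\<close> and \<open>u\<close> near the fixed point.

  \<open>S\<close> is invertible because the energy of \<open>v\<close> is at least
  \<open>\<integral> (a\<^sub>0 - \<Sum>\<bar>a\<^sub>m\<bar>) \<bar>\<nabla>v\<bar>\<^sup>2\<close>: by orthonormality of the chaos polynomials and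
  \<open>\<bar>y\<^sub>m\<bar> \<le> 1\<close>, the form of \<open>G\<^sup>(\<^sup>m\<^sup>)\<close> is bounded by the Euclidean one.\<close>

subsection \<open>A local estimate for bilinear systems\<close>

text \<open>The tensor structure enters only through bilinearity and symmetry, so the estimate lives
  in arbitrary normed spaces. The argument of \<open>Ti\<close> is the image of
  \<open>v - v0\<close> under R, because \<open>u0\<close> is what \<open>Ti\<close> makes of
  \<open>v0\<close>.\<close>

lemma bilinear_iteration_local_bound:
  fixes Dl :: "'p::real_normed_vector \<Rightarrow> 'p \<Rightarrow> 'p" and T :: "'p \<Rightarrow> 'v::real_normed_vector \<Rightarrow> 'v"
    and B :: "'v \<Rightarrow> 'v \<Rightarrow> 'p" and Di :: "'p \<Rightarrow> 'p" and Ti :: "'v \<Rightarrow> 'v"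
  assumes bil: "bounded_bilinear Dl" "bounded_bilinear T" "bounded_bilinear B"
    and lin: "bounded_linear Di" "bounded_linear Ti"
    and sym: "\<And>x y. Dl x y = Dl y x" "\<And>x y. B x y = B y x"
    and inv: "\<And>x. Di (Dl s0 x) = x" "\<And>x. Ti (T s0 x) = x"
    and fixpt: "Dl s0 s0 = B v0 v0" "T s0 u0 = v0"
  shows "\<exists>\<delta>>0. \<exists>C>0. \<forall>s v u. norm (s - s0) < \<delta> \<and> norm (u - u0) < \<delta> \<and> Dl s s = B v v \<and> T s u = v \<longrightarrow>
    norm (s - s0) \<le> C * norm (v - v0) \<and>
    norm (u - u0 - Ti (v - v0 - T (Di (B v0 (v - v0))) u0)) \<le> C * (norm (v - v0))\<^sup>2"
proof -
  interpret D: bounded_bilinear Dl by fact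
  interpret T: bounded_bilinear T by fact
  interpret B: bounded_bilinear B by fact
  interpret Di: bounded_linear Di by fact
  interpret Ti: bounded_linear Ti by fact
  obtain \<kappa> where \<kappa>: "\<kappa> > 0" "\<And>x y. norm (Dl x y) \<le> norm x * norm y * \<kappa>" using D.pos_bounded by auto
  obtain \<tau> where \<tau>: "\<tau> > 0" "\<And>x y. norm (T x y) \<le> norm x * norm y * \<tau>" using T.pos_bounded by auto
  obtain \<beta> where \<beta>: "\<beta> > 0" "\<And>x y. norm (B x y) \<le> norm x * norm y * \<beta>" using B.pos_bounded by auto
  obtain a where a: "a > 0" "\<And>x. norm (Di x) \<le> norm x * a" using Di.pos_bounded by auto
  obtain b where b: "b > 0" "\<And>x. norm (Ti x) \<le> norm x * b" using Ti.pos_bounded by auto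
  \<comment> \<open>\<open>W\<close> bounds |w| a priori. \<open>C1\<close> and \<open>C2\<close>
    are Lipschitz constants for d and e in terms of w; their factors 2 come from moving half of |d|
    or |e| to the left-hand side. \<open>C3\<close> collects the quadratic error of d and the mixed
    term \<open>T d e\<close>.\<close>
  define W where "W = \<tau> * (norm s0 + norm u0 + 1)"
  define C1 where "C1 = a * \<beta> * (2 * norm v0 + W)"
  define C2 where "C2 = 2 * b * (1 + \<tau> * norm u0 * C1)"
  define C3 where "C3 = b * \<tau> * (norm u0 * (a * \<beta> / 2 + a * \<kappa> * C1\<^sup>2 / 2) + C1 * C2)"
  \<comment> \<open>Radius 1 serves the bound \<open>W\<close>. The second radius makes the
    contribution of \<open>Dl d d\<close> to |d| at most |d|/2, the third makes that of
    \<open>T d e\<close> to |e| at most |e|/2.\<close>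
  define \<delta> where "\<delta> = min 1 (min (1 / (a * \<kappa>)) (1 / (2 * b * \<tau>)))"
  have W0: "W \<ge> 0" using \<tau> by (simp add: W_def)
  have C10: "C1 \<ge> 0" using a \<beta> W0 by (simp add: C1_def)
  have C20: "C2 \<ge> 0" using b \<tau> C10 by (simp add: C2_def)
  have C30: "C3 \<ge> 0" using a b \<tau> \<kappa> \<beta> C10 C20 by (simp add: C3_def)
  have "\<delta> > 0" using a b \<kappa> \<tau> by (simp add: \<delta>_def)
  moreover have "norm (s - s0) \<le> (1 + C1 + C3) * norm (v - v0) \<and>
    norm (u - u0 - Ti (v - v0 - T (Di (B v0 (v - v0))) u0)) \<le> (1 + C1 + C3) * (norm (v - v0))\<^sup>2"
    if s: "norm (s - s0) < \<delta>" and u: "norm (u - u0) < \<delta>" and eqs: "Dl s s = B v v" "T s u = v" for s v u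
  proof -
    define d where "d = s - s0"
    define w where "w = v - v0"
    define e where "e = u - u0"
    have sd: "s = s0 + d" and vw: "v = v0 + w" and ue: "u = u0 + e"
      by (auto simp: d_def w_def e_def)
    have small: "norm d \<le> 1" "norm e \<le> 1" "a * \<kappa> * norm d \<le> 1" "b * \<tau> * norm d \<le> 1/2"
      using s u a b \<kappa> \<tau> by (auto simp: \<delta>_def d_def e_def field_simps)
    \<comment> \<open>Subtract the equation at the fixed point from the one at (s, v); by symmetry
      the two cross terms on each side coincide, whence the factors 2.\<close>
    have "2 *\<^sub>R Dl s0 d = 2 *\<^sub>R B v0 w + B w w - Dl d d"
      using eqs(1) fixpt(1) by (simp add: sd vw D.add_left D.add_right B.add_left B.add_right
          sym(1)[of d s0] sym(2)[of w v0] scaleR_2 algebra_simps)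
    then have "Dl s0 d = (1/2) *\<^sub>R (2 *\<^sub>R B v0 w + B w w - Dl d d)"
      by (metis (no_types, lifting) scaleR_scaleR scaleR_one divide_self zero_neq_numeral times_divide_eq_left mult_1)
    then have "Dl s0 d = B v0 w + (1/2) *\<^sub>R B w w - (1/2) *\<^sub>R Dl d d"
      by (simp add: scaleR_add_right scaleR_diff_right)
    then have d_eq: "d = Di (B v0 w) + (1/2) *\<^sub>R Di (B w w) - (1/2) *\<^sub>R Di (Dl d d)"
      by (metis inv(1) Di.add Di.diff Di.scaleR)
    have w_eq: "w = T s0 e + T d u0 + T d e"
      using eqs(2) fixpt(2) by (simp add: sd vw ue T.add_left T.add_right algebra_simps)
    then have e_eq: "e = Ti (w - T d u0 - T d e)" by (simp add: inv(2))
    have nT: "norm (T x y) \<le> \<tau> * (p * q)" if "norm x \<le> p" "norm y \<le> q" for x y p q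
      using \<tau>(2)[of x y] \<tau>(1) mult_mono[OF that] that norm_ge_zero[of x] norm_ge_zero[of y]
      by (smt (verit) mult.commute mult_left_mono)
    have wW: "norm w \<le> W"
    proof -
      have "norm w \<le> norm (T s0 e) + norm (T d u0) + norm (T d e)"
        unfolding w_eq by (meson norm_triangle_le norm_triangle_ineq order_refl add_mono)
      also have "\<dots> \<le> \<tau> * (norm s0 * 1) + \<tau> * (1 * norm u0) + \<tau> * (1 * 1)"
        using small by (intro add_mono nT) auto
      finally show ?thesis by (simp add: W_def algebra_simps)
    qed
    have nB: "norm (Di (B x y)) \<le> a * \<beta> * (norm x * norm y)" for x y
      using a(2)[of "B x y"] \<beta>(2)[of x y] a(1)
      by (smt (verit, best) mult.assoc mult.commute mult_left_mono)
    have nD: "norm (Di (Dl d d)) \<le> a * \<kappa> * (norm d * norm d)"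
      using a(2)[of "Dl d d"] \<kappa>(2)[of d d] a(1)
      by (smt (verit, best) mult.assoc mult.commute mult_left_mono)
    have rem: "norm (d - Di (B v0 w)) \<le> a * \<beta> / 2 * (norm w)\<^sup>2 + a * \<kappa> / 2 * (norm d)\<^sup>2"
    proof -
      have "d - Di (B v0 w) = (1/2) *\<^sub>R Di (B w w) - (1/2) *\<^sub>R Di (Dl d d)"
        by (subst d_eq) simp
      then have "norm (d - Di (B v0 w)) \<le> norm (Di (B w w)) / 2 + norm (Di (Dl d d)) / 2"
        using norm_triangle_ineq4[of "(1/2) *\<^sub>R Di (B w w)" "(1/2) *\<^sub>R Di (Dl d d)"] by simp
      then show ?thesis using nB[of w w] nD by (simp add: power2_eq_square)
    qed
    \<comment> \<open>Both quadratic terms of \<open>rem\<close> are made linear: one factor |w| is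
      replaced by \<open>W\<close>, and one factor |d| is absorbed by smallness. The remaining |d|/2
      goes to the left-hand side.\<close>
    have dC: "norm d \<le> C1 * norm w"
    proof -
      have "norm d \<le> norm (Di (B v0 w)) + norm (d - Di (B v0 w))"
        by (metis add.commute diff_add_cancel norm_triangle_ineq)
      also have "\<dots> \<le> a * \<beta> * (norm v0 * norm w) + (a * \<beta> / 2 * (norm w)\<^sup>2 + a * \<kappa> / 2 * (norm d)\<^sup>2)"
        using nB rem by (rule add_mono)
      also have "a * \<beta> / 2 * (norm w)\<^sup>2 \<le> a * \<beta> / 2 * (W * norm w)"
        using wW a \<beta> by (intro mult_left_mono) (auto simp: power2_eq_square intro: mult_right_mono)
      also have "a * \<kappa> / 2 * (norm d)\<^sup>2 \<le> 1/2 * norm d"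
        using mult_right_mono[OF small(3), of "norm d"] by (simp add: power2_eq_square)
      finally show ?thesis by (simp add: C1_def algebra_simps)
    qed
    have eC: "norm e \<le> C2 * norm w"
    proof -
      have "norm e \<le> norm (w - T d u0 - T d e) * b" using e_eq b(2) by metis
      also have "\<dots> \<le> (norm w + \<tau> * (norm d * norm u0) + \<tau> * (norm d * norm e)) * b"
        using b(1) nT[of d "norm d" u0 "norm u0"] nT[of d "norm d" e "norm e"]
        by (intro mult_right_mono norm_triangle_le_diff add_mono) auto
      also have "\<dots> = norm w * b + b * \<tau> * norm u0 * norm d + (b * \<tau> * norm d) * norm e"
        by (simp add: algebra_simps)
      also have "(b * \<tau> * norm d) * norm e \<le> 1/2 * norm e"
        by (rule mult_right_mono[OF small(4)]) simp
      also have "b * \<tau> * norm u0 * norm d \<le> b * \<tau> * norm u0 * (C1 * norm w)"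
        using dC b \<tau> by (intro mult_left_mono) auto
      finally show ?thesis by (simp add: C2_def algebra_simps)
    qed
    \<comment> \<open>After insertion of the exact equation for e, only two deviations from the
      linearisation survive: d in place of its linear part, and the product of d and e. Both are
      quadratic in w.\<close>
    have "e - Ti (w - T (Di (B v0 w)) u0) = Ti (- T (d - Di (B v0 w)) u0 - T d e)"
      by (subst e_eq) (simp flip: Ti.diff add: T.diff_left algebra_simps)
    then have "norm (e - Ti (w - T (Di (B v0 w)) u0)) \<le> norm (- T (d - Di (B v0 w)) u0 - T d e) * b"
      using b(2) by metis
    also have "\<dots> \<le> (\<tau> * (norm (d - Di (B v0 w)) * norm u0) + \<tau> * ((C1 * norm w) * (C2 * norm w))) * b"
      using b(1) dC eC nT[of "d - Di (B v0 w)" "norm (d - Di (B v0 w))" u0 "norm u0"]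
          nT[OF dC eC]
      by (intro mult_right_mono norm_triangle_le_diff add_mono) auto
    also have "\<dots> \<le> (\<tau> * ((a * \<beta> / 2 * (norm w)\<^sup>2 + a * \<kappa> / 2 * (C1 * norm w)\<^sup>2) * norm u0)
        + \<tau> * ((C1 * norm w) * (C2 * norm w))) * b"
    proof -
      have "norm (d - Di (B v0 w)) \<le> a * \<beta> / 2 * (norm w)\<^sup>2 + a * \<kappa> / 2 * (C1 * norm w)\<^sup>2"
        using rem dC a \<kappa> by (smt (verit) mult_left_mono norm_ge_zero power_mono divide_nonneg_pos mult_nonneg_nonneg)
      then show ?thesis using \<tau> b C10 C20 by (intro mult_right_mono add_mono mult_left_mono) auto
    qed
    also have "\<dots> = C3 * (norm w)\<^sup>2"
      by (simp add: C3_def power2_eq_square algebra_simps)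
    finally have "norm (e - Ti (w - T (Di (B v0 w)) u0)) \<le> (1 + C1 + C3) * (norm w)\<^sup>2"
      using C10 by (smt (verit) mult_right_mono zero_le_power2)
    moreover have "norm d \<le> (1 + C1 + C3) * norm w"
      using dC C30 by (smt (verit) mult_right_mono norm_ge_zero)
    ultimately show ?thesis by (simp add: d_def e_def w_def)
  qed
  moreover have "1 + C1 + C3 > 0" using C10 C30 by simp
  ultimately show ?thesis by meson
qed

text \<open>Perturbation of a linear system, meant for the eigenvalue coefficients: the difference
  of the solutions solves the unperturbed system with right-hand side
  \<open>- Dl (s - s0) \<mu>\<close>. The bound covers every solution \<open>\<mu>\<close>, unique
  or not.\<close>

lemma bilinear_solution_Lipschitz:
  fixes Dl :: "'p::real_normed_vector \<Rightarrow> 'q::real_normed_vector \<Rightarrow> 'r::real_normed_vector"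
    and Di :: "'r \<Rightarrow> 'q"
  assumes "bounded_bilinear Dl" "bounded_linear Di" "\<And>x. Di (Dl s0 x) = x"
  shows "\<exists>\<delta>>0. \<exists>C>0. \<forall>s \<mu>. norm (s - s0) < \<delta> \<and> Dl s \<mu> = Dl s0 \<mu>0 \<longrightarrow>
    norm (\<mu> - \<mu>0) \<le> C * norm (s - s0)"
proof -
  interpret D: bounded_bilinear Dl by fact
  interpret Di: bounded_linear Di by fact
  obtain \<kappa> where \<kappa>: "\<kappa> > 0" "\<And>x y. norm (Dl x y) \<le> norm x * norm y * \<kappa>" using D.pos_bounded by auto
  obtain a where a: "a > 0" "\<And>x. norm (Di x) \<le> norm x * a" using Di.pos_bounded by auto
  \<comment> \<open>With this radius the coefficient of |\<open>\<mu> - \<mu>0\<close>| on the right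
    is at most 1/2 and can be absorbed. The summand 1 keeps the constant positive when
    \<open>\<mu>0\<close> is zero.\<close>
  have "norm (\<mu> - \<mu>0) \<le> (2 * a * \<kappa> * norm \<mu>0 + 1) * norm (s - s0)"
    if s: "norm (s - s0) < 1 / (2 * a * \<kappa>)" and eq: "Dl s \<mu> = Dl s0 \<mu>0" for s \<mu>
  proof -
    have "Dl s0 (\<mu> - \<mu>0) = - Dl (s - s0) \<mu>" using eq by (simp add: D.diff_left D.diff_right)
    then have "\<mu> - \<mu>0 = Di (- Dl (s - s0) \<mu>)" by (metis assms(3))
    then have "norm (\<mu> - \<mu>0) \<le> norm (Dl (s - s0) \<mu>) * a" using a(2) by (metis norm_minus_cancel)
    also have "\<dots> \<le> norm (s - s0) * norm \<mu> * \<kappa> * a"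
      using a \<kappa>(2) by (intro mult_right_mono) auto
    also have "\<dots> \<le> norm (s - s0) * (norm \<mu>0 + norm (\<mu> - \<mu>0)) * \<kappa> * a"
      using a \<kappa> norm_triangle_sub[of \<mu> \<mu>0] by (intro mult_right_mono mult_left_mono) auto
    also have "\<dots> = a * \<kappa> * norm \<mu>0 * norm (s - s0) + (a * \<kappa> * norm (s - s0)) * norm (\<mu> - \<mu>0)"
      by (simp add: algebra_simps)
    also have "(a * \<kappa> * norm (s - s0)) * norm (\<mu> - \<mu>0) \<le> 1/2 * norm (\<mu> - \<mu>0)"
      using s a \<kappa> by (intro mult_right_mono) (auto simp: field_simps)
    finally have "norm (\<mu> - \<mu>0) \<le> 2 * a * \<kappa> * norm \<mu>0 * norm (s - s0)" by (simp add: algebra_simps)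
    then show ?thesis using norm_ge_zero[of "s - s0"] unfolding distrib_right mult_1 by linarith
  qed
  moreover have "1 / (2 * a * \<kappa>) > 0" "2 * a * \<kappa> * norm \<mu>0 + 1 > 0"
    using a \<kappa> by (auto intro!: add_nonneg_pos)
  ultimately show ?thesis by meson
qed

subsection \<open>Orthonormality of the Legendre chaos\<close>

abbreviation sym_uniform :: "real measure" where
  "sym_uniform \<equiv> uniform_measure lborel {-1..1}"

lemma prob_space_sym_uniform: "prob_space sym_uniform"
  by (rule prob_space_uniform_measure) auto

lemma integral_sym_uniform:
  fixes f :: "real \<Rightarrow> real"
  assumes "continuous_on UNIV f"
  shows "integrable sym_uniform f" "(LINT t|sym_uniform. f t) = integral {-1..1} f / 2"
proof -
  have [measurable]: "f \<in> borel_measurable borel"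
    using assms by (rule borel_measurable_continuous_onI)
  have si: "set_integrable lborel {-1..1} f"
    by (intro borel_integrable_atLeastAtMost') (rule continuous_on_subset[OF assms], simp)
  have dens: "sym_uniform = density lborel (\<lambda>x. ennreal (indicator {-1..1} x / 2))"
    unfolding uniform_measure_def
    by (intro density_cong) (auto simp: indicator_def divide_ennreal simp flip: ennreal_numeral ennreal_1)
  show "integrable sym_uniform f"
    unfolding dens using integrable_mult_right[OF si[unfolded set_integrable_def], of "1/2"]
    by (subst integrable_density) auto
  have "(LINT t|sym_uniform. f t) = (LINT t|lborel. (indicator {-1..1} t / 2) * f t)"
    unfolding dens by (subst integral_density) auto
  also have "\<dots> = (LBINT t:{-1..1}. f t) / 2"
    by (simp add: set_lebesgue_integral_def)
  also have "(LBINT t:{-1..1}. f t) = integral {-1..1} f"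
    using si by (rule set_borel_integral_eq_integral(2))
  finally show "(LINT t|sym_uniform. f t) = integral {-1..1} f / 2" .
qed

section \<open>Orthogonality of the Legendre polynomials from Rodrigues' formula\<close>

lemma integral_poly_by_parts:
  fixes p q :: "real poly"
  assumes "poly (p * q) (-1) = 0" "poly (p * q) 1 = 0"
  shows "integral {-1..1} (poly (q * pderiv p)) = - integral {-1..1} (poly (pderiv q * p))"
proof -
  have i: "poly r integrable_on {-1..1::real}" for r :: "real poly"
    by (intro integrable_continuous_real continuous_intros)
  have "(poly (pderiv (p * q)) has_integral (poly (p * q) 1 - poly (p * q) (-1))) {-1..1}"
    by (intro fundamental_theorem_of_calculus)
       (auto intro!: DERIV_subset[OF poly_DERIV] simp del: poly_mult
          simp flip: has_real_derivative_iff_has_vector_derivative)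
  then have "integral {-1..1} (poly (pderiv (p * q))) = 0"
    using assms by (simp add: integral_unique del: poly_mult)
  moreover have "poly (pderiv (p * q)) = (\<lambda>x. poly (q * pderiv p) x + poly (pderiv q * p) x)"
    by (auto simp: pderiv_mult algebra_simps)
  ultimately show ?thesis using integral_add[OF i i] by (simp add: eq_neg_iff_add_eq_0 del: poly_mult)
qed

text \<open>Each differentiation costs at most one factor w. With w vanishing at both endpoints,
  this removes the boundary terms in the repeated integration by parts below.\<close>

lemma power_dvd_pderiv_power:
  fixes w :: "'a::idom poly"
  assumes "j \<le> n"
  shows "w ^ (n - j) dvd (pderiv ^^ j) (w ^ n)"
  using assms
proof (induction j)
  case (Suc j)
  then obtain r where r: "(pderiv ^^ j) (w ^ n) = w ^ (n - j) * r" by (auto elim: dvdE)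
  have "n - j = Suc (n - Suc j)" using Suc.prems by simp
  then have "(pderiv ^^ Suc j) (w ^ n) = w ^ (n - Suc j) *
      (smult (of_nat (Suc (n - Suc j))) (pderiv w) * r + w * pderiv r)"
    using r by (simp add: pderiv_mult pderiv_power_Suc algebra_simps del: power_Suc of_nat_Suc)
       (simp add: algebra_simps)
  then show ?case by simp
qed simp

text \<open>Integration by parts moves the derivatives one at a time onto q, until they annihilate
  it because its degree is below j. The exponent n stays fixed in the induction while j decreases,
  so a factor w is always left at the endpoints.\<close>

lemma integral_mult_iterated_pderiv_eq_0:
  fixes q w :: "real poly"
  assumes "poly w 1 = 0" "poly w (-1) = 0" "degree q < j" "j \<le> n"
  shows "integral {-1..1} (poly (q * (pderiv ^^ j) (w ^ n))) = 0"
  using assms(3,4)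
proof (induction j arbitrary: q)
  case (Suc j)
  have "w dvd (pderiv ^^ j) (w ^ n)"
    using power_dvd_pderiv_power[of j n w] Suc.prems dvd_power[of "n - j" w]
    by (auto intro: dvd_trans)
  then have "poly ((pderiv ^^ j) (w ^ n)) 1 = 0" "poly ((pderiv ^^ j) (w ^ n)) (-1) = 0"
    using assms(1,2) by (auto elim!: dvdE)
  then have eq: "integral {-1..1} (poly (q * (pderiv ^^ Suc j) (w ^ n))) =
      - integral {-1..1} (poly (pderiv q * (pderiv ^^ j) (w ^ n)))"
    using integral_poly_by_parts[of "(pderiv ^^ j) (w ^ n)" q] by simp
  show ?case
  \<comment> \<open>Constants are treated apart: the derivative is then zero, but its degree 0 is
    not below j when j = 0, so the induction hypothesis would not apply.\<close>
  proof (cases "degree q = 0")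
    case True
    then have "pderiv q = 0" by (simp add: pderiv_eq_0_iff)
    then show ?thesis using eq by (simp del: funpow.simps poly_mult) (simp add: poly_0[abs_def])
  next
    case False
    then have "degree (pderiv q) < j" using Suc.prems by (simp add: degree_pderiv)
    then show ?thesis using eq Suc.IH[of "pderiv q"] Suc.prems by (simp del: funpow.simps poly_mult)
  qed
qed simp

lemma degree_legendre: "degree (legendre p) = p"
proof -
  have "degree ((pderiv ^^ j) f) = degree f - j" for j and f :: "real poly"
    by (induction j) (auto simp: degree_pderiv)
  then have "degree ((pderiv ^^ p) ([:-1, 0, 1:] ^ p :: real poly)) = p"
    by (simp add: degree_power_eq)
  then show ?thesis by (simp add: legendre_def)
qed

lemma legendre_nonzero: "legendre p \<noteq> 0"
proof (cases p)
  case 0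
  then show ?thesis by (simp add: legendre_def)
next
  case (Suc k)
  then show ?thesis using degree_legendre[of p] by fastforce
qed

text \<open>By symmetry let p < q. Rodrigues' formula is unfolded only for the factor of higher
  degree; the other serves as the polynomial of low degree that the derivatives annihilate.\<close>

lemma legendre_orthogonal:
  assumes "p \<noteq> q"
  shows "integral {-1..1} (poly (legendre p * legendre q)) = 0"
proof -
  have "integral {-1..1} (poly (legendre p * legendre q)) = 0" if "p < q" for p q
  proof -
    let ?D = "(pderiv ^^ q) ([:-1, 0, 1:] ^ q :: real poly)"
    have "integral {-1..1} (poly (legendre p * ?D)) = 0"
      by (rule integral_mult_iterated_pderiv_eq_0) (use that in \<open>auto simp: degree_legendre\<close>)
    moreover have "poly (legendre p * legendre q) = (\<lambda>t. 1 / (2 ^ q * fact q) * poly (legendre p * ?D) t)"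
      by (auto simp: legendre_def[of q])
    ultimately show ?thesis by (simp only: integral_mult_right mult_zero_right)
  qed
  from this[of p q] this[of q p] assms show ?thesis by (metis linorder_neqE_nat mult.commute)
qed

text \<open>A zero integral would give q infinitely many roots. This makes the normalising constants
  nonzero.\<close>

lemma integral_poly_square_pos:
  fixes q :: "real poly"
  assumes "q \<noteq> 0"
  shows "integral {-1..1} (\<lambda>t. (poly q t)\<^sup>2) > 0"
proof -
  have c: "continuous_on {-1..1} (\<lambda>t. (poly q t)\<^sup>2)" by (intro continuous_intros)
  have "integral {-1..1} (\<lambda>t. (poly q t)\<^sup>2) \<ge> 0"
    by (intro integral_nonneg integrable_continuous_real c) auto
  moreover have "integral {-1..1} (\<lambda>t. (poly q t)\<^sup>2) \<noteq> 0"
  proof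
    assume "integral {-1..1} (\<lambda>t. (poly q t)\<^sup>2) = 0"
    then have "\<forall>t\<in>{-1..1}. (poly q t)\<^sup>2 = 0"
      using integral_eq_0_iff[OF c] by auto
    then have "{-1..1} \<subseteq> {t. poly q t = 0}" by auto
    then have "finite {-1..1::real}" using poly_roots_finite[OF assms] by (rule finite_subset)
    then show False by (simp add: infinite_Icc)
  qed
  ultimately show ?thesis by simp
qed

lemma legendre_normalized_orthonormal:
  "(LINT t|sym_uniform. poly (legendre_normalized p) t * poly (legendre_normalized q) t) =
    (if p = q then 1 else 0)"
proof -
  define c where "c p = (LINT t|sym_uniform. (poly (legendre p) t)\<^sup>2)" for p
  have c: "c p = integral {-1..1} (\<lambda>t. (poly (legendre p) t)\<^sup>2) / 2" for p
    unfolding c_def by (intro integral_sym_uniform continuous_intros)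
  have cpos: "c p > 0" for p
    using integral_poly_square_pos[OF legendre_nonzero[of p]] by (simp add: c)
  have "(LINT t|sym_uniform. poly (legendre_normalized p) t * poly (legendre_normalized q) t) =
     (LINT t|sym_uniform. (1 / (sqrt (c p) * sqrt (c q))) * poly (legendre p * legendre q) t)"
    by (simp add: legendre_normalized_def c_def field_simps)
  also have "\<dots> = (1 / (sqrt (c p) * sqrt (c q))) * (integral {-1..1} (poly (legendre p * legendre q)) / 2)"
    by (simp only: integral_mult_right_zero) (subst integral_sym_uniform(2), auto intro!: continuous_intros)
  also have "\<dots> = (if p = q then 1 else 0)"
  proof (cases "p = q")
    case True
    have "integral {-1..1} (poly (legendre q * legendre q)) / 2 = c q"
      unfolding c by (intro arg_cong2[where f = "(/)"] arg_cong[where f = "integral _"])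
        (auto simp: fun_eq_iff power2_eq_square)
    then show ?thesis using cpos[of q] True by simp
  qed (simp add: legendre_orthogonal)
  finally show ?thesis .
qed

lemma legendre_normalized_0: "legendre_normalized 0 = 1"
proof -
  interpret prob_space sym_uniform by (rule prob_space_sym_uniform)
  show ?thesis by (simp add: legendre_normalized_def legendre_def prob_space)
qed

section \<open>Chaos polynomials on the infinite product space\<close>

lemma prob_space_param_measure: "prob_space param_measure"
  unfolding param_measure_def by (intro prob_space_PiM prob_space_sym_uniform)

text \<open>The coordinates are independent random variables with uniform law, so expectations of
  products of functions of single coordinates factorise.\<close>

lemma param_expectation_prod:
  assumes "finite I" "I \<subseteq> {1..}" "\<And>m. m \<in> I \<Longrightarrow> continuous_on UNIV (f m)"
  shows "param_expectation (\<lambda>y. \<Prod>m\<in>I. f m (y m)) = (\<Prod>m\<in>I. LINT t|sym_uniform. f m t)"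
    and "integrable param_measure (\<lambda>y. \<Prod>m\<in>I. f m (y m))"
proof -
  interpret P: prob_space param_measure by (rule prob_space_param_measure)
  have [measurable]: "f m \<in> borel_measurable borel" if "m \<in> I" for m
    using assms(3)[OF that] by (rule borel_measurable_continuous_onI)
  have proj: "(\<lambda>y. y m) \<in> param_measure \<rightarrow>\<^sub>M sym_uniform" if "m \<in> I" for m
    unfolding param_measure_def using that assms(2) by (intro measurable_component_singleton) auto
  have distr: "distr param_measure sym_uniform (\<lambda>y. y m) = sym_uniform" if "m \<in> I" for m
    unfolding param_measure_def using that assms(2)
    by (intro distr_PiM_component prob_space_sym_uniform) auto
  have "P.indep_vars (\<lambda>_. sym_uniform) (\<lambda>m y. y m) I"
  proof -
    \<comment> \<open>Points of the product space are extensional on \<open>{1..}\<close>, so the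
      restriction is the identity there. The joint law of the coordinates is thus the product of
      their laws, which is independence.\<close>
    have "distr param_measure param_measure (\<lambda>y. \<lambda>m\<in>{1..}. y m) = distr param_measure param_measure (\<lambda>y. y)"
      by (intro distr_cong) (auto simp: param_measure_def space_PiM PiE_def extensional_restrict)
    moreover have "PiM {1..} (\<lambda>m. distr param_measure sym_uniform (\<lambda>y. y m)) = param_measure"
      unfolding param_measure_def
      by (intro PiM_cong refl distr_PiM_component prob_space_sym_uniform) auto
    ultimately have "P.indep_vars (\<lambda>_. sym_uniform) (\<lambda>m y. y m) {1..}"
      by (subst P.indep_vars_iff_distr_eq_PiM')
         (auto simp flip: param_measure_def, auto simp: param_measure_def)
    then show ?thesis using assms(2) by (rule P.indep_vars_subset)
  qed
  then have "P.indep_vars (\<lambda>_. borel) (\<lambda>m. f m \<circ> (\<lambda>y. y m)) I"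
    by (rule P.indep_vars_compose) simp
  then have ind: "P.indep_vars (\<lambda>_. borel) (\<lambda>m y. f m (y m)) I" by (simp add: comp_def)
  have int: "integrable param_measure (\<lambda>y. f m (y m))" if "m \<in> I" for m
    using integrable_distr_eq[OF proj[OF that], of "f m"] distr[OF that] that
      integral_sym_uniform(1)[OF assms(3)[OF that]] by simp
  have "param_expectation (\<lambda>y. f m (y m)) = (LINT t|sym_uniform. f m t)" if "m \<in> I" for m
    using integral_distr[OF proj[OF that], of "f m"] distr[OF that] that by simp
  then show "param_expectation (\<lambda>y. \<Prod>m\<in>I. f m (y m)) = (\<Prod>m\<in>I. LINT t|sym_uniform. f m t)"
    using P.indep_vars_lebesgue_integral[OF assms(1) ind int] by simp
  show "integrable param_measure (\<lambda>y. \<Prod>m\<in>I. f m (y m))"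
    by (rule P.indep_vars_integrable[OF assms(1) ind int])
qed

lemma multi_index_pos: "multi_index \<alpha> \<Longrightarrow> \<alpha> m \<noteq> 0 \<Longrightarrow> m \<ge> 1"
  by (cases m) (auto simp: multi_index_def)

text \<open>The normalized Legendre polynomial of degree 0 is 1, so inactive coordinates contribute
  nothing. Two chaos polynomials can thereby be multiplied over a common index set.\<close>

lemma chaos_poly_superset:
  assumes "finite I" "{m. \<alpha> m \<noteq> 0} \<subseteq> I"
  shows "chaos_poly \<alpha> y = (\<Prod>m\<in>I. poly (legendre_normalized (\<alpha> m)) (y m))"
  unfolding chaos_poly_def
  by (intro prod.mono_neutral_left assms) (auto simp: legendre_normalized_0)

text \<open>Over the union of the two supports the expectation becomes a product of univariate ones.
  Distinct multi-indices differ at some coordinate of that union, and the factor there is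
  zero.\<close>

lemma chaos_poly_orthonormal:
  assumes "multi_index \<alpha>" "multi_index \<beta>"
  shows "param_expectation (\<lambda>y. chaos_poly \<alpha> y * chaos_poly \<beta> y) = (if \<alpha> = \<beta> then 1 else 0)"
    and "integrable param_measure (\<lambda>y. chaos_poly \<alpha> y * chaos_poly \<beta> y)"
proof -
  define I where "I = {m. \<alpha> m \<noteq> 0} \<union> {m. \<beta> m \<noteq> 0}"
  define f where "f m t = poly (legendre_normalized (\<alpha> m)) t * poly (legendre_normalized (\<beta> m)) t" for m t
  have I: "finite I" "I \<subseteq> {1..}" using multi_index_pos[OF assms(1)] multi_index_pos[OF assms(2)] assms
    by (auto simp: I_def multi_index_def)
  have eq: "chaos_poly \<alpha> y * chaos_poly \<beta> y = (\<Prod>m\<in>I. f m (y m))" for y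
    using chaos_poly_superset[OF I(1), of \<alpha>] chaos_poly_superset[OF I(1), of \<beta>]
    by (auto simp: I_def f_def prod.distrib)
  have cont: "continuous_on UNIV (f m)" for m unfolding f_def by (intro continuous_intros)
  show "integrable param_measure (\<lambda>y. chaos_poly \<alpha> y * chaos_poly \<beta> y)"
    unfolding eq by (rule param_expectation_prod(2)[OF I cont])
  have "param_expectation (\<lambda>y. chaos_poly \<alpha> y * chaos_poly \<beta> y) = (\<Prod>m\<in>I. if \<alpha> m = \<beta> m then 1 else 0)"
    unfolding eq param_expectation_prod(1)[OF I cont]
    by (simp add: f_def[abs_def] legendre_normalized_orthonormal)
  also have "\<dots> = (if \<alpha> = \<beta> then 1 else 0)"
  proof (cases "\<alpha> = \<beta>")
    case False
    then obtain m where "\<alpha> m \<noteq> \<beta> m" by auto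
    then have "m \<in> I" "(if \<alpha> m = \<beta> m then 1 else 0) = (0::real)" by (auto simp: I_def)
    then have "(\<Prod>m\<in>I. if \<alpha> m = \<beta> m then 1 else 0) = (0::real)"
      by (intro prod_zero I(1) bexI[of _ m])
    then show ?thesis using False by simp
  qed simp
  finally show "param_expectation (\<lambda>y. chaos_poly \<alpha> y * chaos_poly \<beta> y) = (if \<alpha> = \<beta> then 1 else 0)" .
qed

lemma chaos_poly_measurable [measurable]:
  assumes "multi_index \<alpha>"
  shows "chaos_poly \<alpha> \<in> borel_measurable param_measure"
proof -
  have "(\<lambda>y. \<Prod>m\<in>{m. \<alpha> m \<noteq> 0}. poly (legendre_normalized (\<alpha> m)) (y m)) \<in> borel_measurable param_measure"
    using assms
    by (intro param_expectation_prod(2)[THEN borel_measurable_integrable])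
       (use multi_index_pos[OF assms] in \<open>auto simp: multi_index_def intro!: continuous_intros\<close>)
  then show ?thesis by (simp add: chaos_poly_def[abs_def])
qed

text \<open>The bound is almost sure rather than pointwise, because each factor measure has the
  whole line as its space.\<close>

lemma AE_param_measure_bounded:
  assumes "m \<ge> 1"
  shows "AE y in param_measure. \<bar>y m\<bar> \<le> 1"
proof -
  have "AE t in sym_uniform. \<bar>t\<bar> \<le> 1"
    by (intro AE_uniform_measureI) (auto simp: abs_le_iff)
  then show ?thesis
    unfolding param_measure_def using assms
    by (intro AE_PiM_component[where P = "\<lambda>t. \<bar>t\<bar> \<le> 1"]) (auto intro: prob_space_sym_uniform)
qed

lemma G_moment_quadratic_form_bound:
  fixes A :: "'p::finite \<Rightarrow> nat \<Rightarrow> nat"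
  assumes "\<And>p. multi_index (A p)" "inj A"
  shows "\<bar>c \<bullet> (G_moment A m *v c)\<bar> \<le> (norm c)\<^sup>2"
proof (cases "m = 0")
  case True
  then show ?thesis by (simp add: G_moment_def power2_norm_eq_inner)
next
  case False
  \<comment> \<open>f is the chaos expansion with coefficients c. By Parseval, where injectivity of
    A enters, the expectation of its square is |c|^2, while the form of \<open>G_moment A m\<close>
    is the expectation of y_m f^2.\<close>
  define f where "f y = (\<Sum>q\<in>UNIV. c $ q * chaos_poly (A q) y)" for y
  have sq: "(f y)\<^sup>2 = (\<Sum>q\<in>UNIV. \<Sum>r\<in>UNIV. c $ q * c $ r * (chaos_poly (A q) y * chaos_poly (A r) y))" for y
    by (simp add: f_def power2_eq_square sum_product algebra_simps)
  have [measurable]: "chaos_poly (A q) \<in> borel_measurable param_measure" for q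
    by (rule chaos_poly_measurable[OF assms(1)])
  have [measurable]: "(\<lambda>y. y m) \<in> borel_measurable param_measure"
    using measurable_component_singleton[of m "{1..}" "\<lambda>_. sym_uniform"] False
      measurable_cong_sets[of param_measure param_measure sym_uniform borel]
    by (simp add: param_measure_def Suc_le_eq)
  have bd: "AE y in param_measure. \<bar>y m\<bar> \<le> 1" using AE_param_measure_bounded[of m] False by simp
  have int: "integrable param_measure (\<lambda>y. chaos_poly (A q) y * chaos_poly (A r) y)" for q r
    by (intro chaos_poly_orthonormal assms)
  have intm: "integrable param_measure (\<lambda>y. y m * chaos_poly (A q) y * chaos_poly (A r) y)" for q r
  proof (rule Bochner_Integration.integrable_bound[OF int[of q r]])
    show "AE y in param_measure. norm (y m * chaos_poly (A q) y * chaos_poly (A r) y)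
        \<le> norm (chaos_poly (A q) y * chaos_poly (A r) y)"
      using bd by (auto elim!: eventually_mono simp: abs_mult mult.assoc intro!: mult_left_le_one_le)
  qed measurable
  have "param_expectation (\<lambda>y. (f y)\<^sup>2) = (\<Sum>q\<in>UNIV. \<Sum>r\<in>UNIV. c $ q * c $ r * (if A q = A r then 1 else 0))"
    unfolding sq using int by (simp add: chaos_poly_orthonormal(1) assms(1))
  also have "\<dots> = (norm c)\<^sup>2"
    using assms(2) by (simp add: inj_eq power2_norm_eq_inner inner_vec_def if_distrib cong: if_cong)
  finally have E: "param_expectation (\<lambda>y. (f y)\<^sup>2) = (norm c)\<^sup>2" .
  have E_int: "integrable param_measure (\<lambda>y. (f y)\<^sup>2)" unfolding sq using int by auto
  have ysq: "y m * (f y)\<^sup>2 = (\<Sum>q\<in>UNIV. \<Sum>r\<in>UNIV. c $ q * c $ r * (y m * chaos_poly (A q) y * chaos_poly (A r) y))" for y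
    by (simp add: sq sum_distrib_left algebra_simps)
  have "c \<bullet> (G_moment A m *v c) =
      (\<Sum>q\<in>UNIV. \<Sum>r\<in>UNIV. c $ q * c $ r * param_expectation (\<lambda>y. y m * chaos_poly (A q) y * chaos_poly (A r) y))"
    using False
    by (simp add: G_moment_def inner_vec_def matrix_vector_mult_def sum_distrib_left algebra_simps)
  also have "\<dots> = param_expectation (\<lambda>y. y m * (f y)\<^sup>2)"
    unfolding ysq using intm by simp
  also have "\<bar>\<dots>\<bar> \<le> param_expectation (\<lambda>y. \<bar>y m * (f y)\<^sup>2\<bar>)"
    by (rule integral_abs_bound)
  also have "\<dots> \<le> param_expectation (\<lambda>y. (f y)\<^sup>2)"
  proof (rule integral_mono_AE[OF _ E_int])
    show "integrable param_measure (\<lambda>y. \<bar>y m * (f y)\<^sup>2\<bar>)"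
      unfolding ysq
      by (intro integrable_abs Bochner_Integration.integrable_sum Bochner_Integration.integrable_mult_right intm)
    show "AE y in param_measure. \<bar>y m * (f y)\<^sup>2\<bar> \<le> (f y)\<^sup>2"
    proof (rule eventually_mono[OF bd])
      fix y :: "nat \<Rightarrow> real" assume "\<bar>y m\<bar> \<le> 1"
      then have "\<bar>y m\<bar> * (f y)\<^sup>2 \<le> 1 * (f y)\<^sup>2" by (rule mult_right_mono) simp
      then show "\<bar>y m * (f y)\<^sup>2\<bar> \<le> (f y)\<^sup>2" by (simp add: abs_mult)
    qed
  qed
  finally show ?thesis unfolding E .
qed

subsection \<open>$L^2(D)$ and vanishing weak gradients\<close>

text \<open>The discriminant argument behind the Cauchy-Schwarz inequality, stated for real numbers
  so that it serves both the L2 integral and the mass form.\<close>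

lemma discriminant_le:
  fixes A B C :: real
  assumes "\<And>t. A + 2 * t * B + t\<^sup>2 * C \<ge> 0" "C \<ge> 0"
  shows "B\<^sup>2 \<le> A * C"
proof (cases "C = 0")
  case True
  have "B = 0"
  proof (rule ccontr)
    assume "B \<noteq> 0"
    \<comment> \<open>At this t the expression, now affine in t, equals -1.\<close>
    then show False using assms(1)[of "- (A + 1) / (2 * B)"] True by (simp add: field_simps)
  qed
  then show ?thesis using True by simp
next
  case False
  then have "C > 0" using assms(2) by simp
  moreover have "A + 2 * (- B / C) * B + (- B / C)\<^sup>2 * C \<ge> 0" by (rule assms)
  ultimately show ?thesis by (simp add: field_simps power2_eq_square)
qed

lemma integrable_mult_of_squares:
  fixes f g :: "'a \<Rightarrow> real"
  assumes [measurable]: "f \<in> borel_measurable M" "g \<in> borel_measurable M"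
    and "integrable M (\<lambda>x. (f x)\<^sup>2)" "integrable M (\<lambda>x. (g x)\<^sup>2)"
  shows "integrable M (\<lambda>x. f x * g x)"
proof (rule Bochner_Integration.integrable_bound)
  show "integrable M (\<lambda>x. (f x)\<^sup>2 + (g x)\<^sup>2)" using assms by auto
  have "\<bar>a * b\<bar> \<le> a\<^sup>2 + b\<^sup>2" for a b :: real
    using zero_le_power2[of "\<bar>a\<bar> - \<bar>b\<bar>"] zero_le_power2[of "a"] zero_le_power2[of "b"]
    unfolding power2_diff abs_mult power2_abs by linarith
  then show "AE x in M. norm (f x * g x) \<le> norm ((f x)\<^sup>2 + (g x)\<^sup>2)" by simp
qed measurable

lemma integral_Cauchy_Schwarz:
  fixes f g :: "'a \<Rightarrow> real"
  assumes "f \<in> borel_measurable M" "g \<in> borel_measurable M"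
    and "integrable M (\<lambda>x. (f x)\<^sup>2)" "integrable M (\<lambda>x. (g x)\<^sup>2)"
  shows "(LINT x|M. f x * g x)\<^sup>2 \<le> (LINT x|M. (f x)\<^sup>2) * (LINT x|M. (g x)\<^sup>2)"
proof (rule discriminant_le)
  fix t :: real
  note fg = integrable_mult_of_squares[OF assms]
  have "0 \<le> (LINT x|M. (f x + t * g x)\<^sup>2)" by simp
  also have "(\<lambda>x. (f x + t * g x)\<^sup>2) = (\<lambda>x. (f x)\<^sup>2 + (2 * t) * (f x * g x) + t\<^sup>2 * (g x)\<^sup>2)"
    by (auto simp: power2_eq_square algebra_simps)
  also have "(LINT x|M. \<dots> x) = (LINT x|M. (f x)\<^sup>2) + 2 * t * (LINT x|M. f x * g x) + t\<^sup>2 * (LINT x|M. (g x)\<^sup>2)"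
    using assms fg by simp
  finally show "0 \<le> (LINT x|M. (f x)\<^sup>2) + 2 * t * (LINT x|M. f x * g x) + t\<^sup>2 * (LINT x|M. (g x)\<^sup>2)" .
qed simp

text \<open>Cauchy-Schwarz bounds the squared integral by a constant times a null sequence. The
  squeeze is therefore carried out on squares, and the root is taken at the end.\<close>

lemma integral_mult_tendsto_0:
  fixes f :: "'a \<Rightarrow> real" and h :: "nat \<Rightarrow> 'a \<Rightarrow> real"
  assumes "f \<in> borel_measurable M" "\<And>n. h n \<in> borel_measurable M"
    and "integrable M (\<lambda>x. (f x)\<^sup>2)" "\<And>n. integrable M (\<lambda>x. (h n x)\<^sup>2)"
    and "(\<lambda>n. LINT x|M. (h n x)\<^sup>2) \<longlonglongrightarrow> 0"
  shows "(\<lambda>n. LINT x|M. f x * h n x) \<longlonglongrightarrow> 0"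
proof -
  have "(\<lambda>n. (LINT x|M. f x * h n x)\<^sup>2) \<longlonglongrightarrow> 0"
  proof (rule tendsto_sandwich[OF _ _ tendsto_const])
    show "(\<lambda>n. (LINT x|M. (f x)\<^sup>2) * (LINT x|M. (h n x)\<^sup>2)) \<longlonglongrightarrow> 0"
      using tendsto_mult_right_zero[OF assms(5)] .
    show "\<forall>\<^sub>F n in sequentially. (LINT x|M. f x * h n x)\<^sup>2 \<le> (LINT x|M. (f x)\<^sup>2) * (LINT x|M. (h n x)\<^sup>2)"
      using integral_Cauchy_Schwarz[OF assms(1) _ assms(3)] assms(2,4) by simp
  qed auto
  then have "(\<lambda>n. sqrt ((LINT x|M. f x * h n x)\<^sup>2)) \<longlonglongrightarrow> sqrt 0" by (rule tendsto_real_sqrt)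
  then show ?thesis by (simp add: tendsto_rabs_zero_iff)
qed

section \<open>Test functions multiplied by linear functionals\<close>

lemma Ck_on_add:
  "Ck_on k UNIV f \<Longrightarrow> Ck_on k UNIV g \<Longrightarrow> Ck_on k UNIV (\<lambda>x. f x + g x)"
proof (induction k arbitrary: f g)
  case (Suc k)
  have "((\<lambda>x. f x + g x) has_derivative (\<lambda>h. frechet_derivative f (at x) h + frechet_derivative g (at x) h)) (at x)" for x
    using Suc.prems by (intro has_derivative_add) (auto simp flip: frechet_derivative_works)
  then have "(\<lambda>x. f x + g x) differentiable (at x)"
    "frechet_derivative (\<lambda>x. f x + g x) (at x) = (\<lambda>h. frechet_derivative f (at x) h + frechet_derivative g (at x) h)" for x
    by (auto simp: differentiable_def frechet_derivative_at[symmetric])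
  then show ?case using Suc by auto
qed (auto intro: continuous_intros)

lemma Ck_on_cmult: "Ck_on k UNIV f \<Longrightarrow> Ck_on k UNIV (\<lambda>x. c * f x)"
proof (induction k arbitrary: f)
  case (Suc k)
  have "((\<lambda>x. c * f x) has_derivative (\<lambda>h. c * frechet_derivative f (at x) h)) (at x)" for x
    using Suc.prems by (intro has_derivative_mult_right) (auto simp flip: frechet_derivative_works)
  then have "(\<lambda>x. c * f x) differentiable (at x)"
    "frechet_derivative (\<lambda>x. c * f x) (at x) = (\<lambda>h. c * frechet_derivative f (at x) h)" for x
    by (auto simp: differentiable_def frechet_derivative_at[symmetric])
  then show ?case using Suc by auto
qed (auto intro: continuous_intros)

lemma Ck_on_SucD: "Ck_on (Suc k) UNIV f \<Longrightarrow> Ck_on k UNIV f"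
  by (induction k arbitrary: f)
    (auto intro!: continuous_at_imp_continuous_on differentiable_imp_continuous_within)

lemma has_derivative_inner_mult:
  fixes f :: "'a::euclidean_space \<Rightarrow> real"
  assumes "f differentiable (at x)"
  shows "((\<lambda>x. (x \<bullet> b) * f x) has_derivative (\<lambda>h. (h \<bullet> b) * f x + (x \<bullet> b) * frechet_derivative f (at x) h)) (at x)"
proof -
  have "((\<lambda>x. (x \<bullet> b) * f x) has_derivative (\<lambda>h. (x \<bullet> b) * frechet_derivative f (at x) h + (h \<bullet> b) * f x)) (at x)"
    using assms[unfolded frechet_derivative_works]
    by (intro has_derivative_mult has_derivative_inner_left has_derivative_ident)
  then show ?thesis by (simp add: add.commute)
qed

text \<open>The product rule gives two terms: one contains f itself, which is of class C^k by
  \<open>Ck_on_SucD\<close>, and the other is again a linear functional times a derivative of f,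
  covered by the induction hypothesis.\<close>

lemma Ck_on_inner_mult: "Ck_on k UNIV f \<Longrightarrow> Ck_on k UNIV (\<lambda>x. (x \<bullet> b) * f x)"
proof (induction k arbitrary: f)
  case (Suc k)
  then have der: "((\<lambda>x. (x \<bullet> b) * f x) has_derivative
      (\<lambda>h. (h \<bullet> b) * f x + (x \<bullet> b) * frechet_derivative f (at x) h)) (at x)" for x
    by (intro has_derivative_inner_mult) auto
  then have "(\<lambda>x. (x \<bullet> b) * f x) differentiable (at x)"
    "frechet_derivative (\<lambda>x. (x \<bullet> b) * f x) (at x) =
      (\<lambda>h. (h \<bullet> b) * f x + (x \<bullet> b) * frechet_derivative f (at x) h)" for x
    by (auto simp: differentiable_def frechet_derivative_at[symmetric])
  moreover have "Ck_on k UNIV f" using Suc.prems by (rule Ck_on_SucD)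
  ultimately show ?case using Suc by (auto intro!: Ck_on_add Ck_on_cmult)
qed (auto intro!: continuous_intros)

lemma test_function_inner_mult:
  assumes "test_function D \<psi>"
  shows "test_function D (\<lambda>x. (x \<bullet> b) * \<psi> x)"
  using assms unfolding test_function_def by (metis Ck_on_inner_mult mult_zero_right)

lemma test_function_differentiable: "test_function D \<psi> \<Longrightarrow> \<psi> differentiable (at x)"
  by (auto simp: test_function_def dest: spec[of _ "Suc 0"])

lemma test_function_continuous: "test_function D \<psi> \<Longrightarrow> continuous_on UNIV \<psi>"
  by (auto simp: test_function_def dest: spec[of _ 0])

lemma test_function_continuous_deriv:
  "test_function D \<psi> \<Longrightarrow> b \<in> Basis \<Longrightarrow> continuous_on UNIV (\<lambda>x. frechet_derivative \<psi> (at x) b)"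
  by (auto simp: test_function_def dest: spec[of _ "Suc 0"])

lemma continuous_on_classical_grad:
  "test_function D \<psi> \<Longrightarrow> continuous_on UNIV (classical_grad \<psi>)"
  unfolding classical_grad_def[abs_def] by (intro continuous_intros test_function_continuous_deriv)

lemma classical_grad_inner_Basis:
  "b \<in> Basis \<Longrightarrow> classical_grad \<psi> x \<bullet> b = frechet_derivative \<psi> (at x) b"
  by (simp add: classical_grad_def inner_sum_left inner_Basis if_distrib cong: if_cong)

section \<open>Square integrable functions on a bounded domain\<close>

lemma measurable_lebesgue_on_continuous:
  fixes f :: "'a::euclidean_space \<Rightarrow> 'b::euclidean_space"
  assumes "continuous_on UNIV f"
  shows "f \<in> borel_measurable (lebesgue_on D)"
  using borel_measurable_continuous_onI[OF assms]
  by (intro measurable_restrict_space1 measurable_completion) simp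

lemma L2_on_continuous:
  fixes f :: "'a::euclidean_space \<Rightarrow> 'b::euclidean_space"
  assumes "continuous_on UNIV f" "open D" "bounded D"
  shows "L2_on D f"
proof -
  have [measurable]: "f \<in> borel_measurable (lebesgue_on D)"
    using assms(1) by (rule measurable_lebesgue_on_continuous)
  have "compact (closure D)" using assms by simp
  then have "compact (f ` closure D)"
    using assms(1) by (metis compact_continuous_image continuous_on_subset subset_UNIV)
  then have "bounded (f ` D)"
    by (rule bounded_subset[OF compact_imp_bounded image_mono[OF closure_subset]])
  then obtain B where B: "\<And>x. x \<in> D \<Longrightarrow> norm (f x) \<le> B"
    unfolding bounded_iff by auto
  interpret finite_measure "lebesgue_on D"
    using assms by (intro finite_measure_lebesgue_on lmeasurable_open)
  have "integrable (lebesgue_on D) (\<lambda>x. (norm (f x))\<^sup>2)"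
    by (rule integrable_const_bound[of _ "B\<^sup>2"]) (auto intro!: AE_I2 power_mono B)
  then show ?thesis by (simp add: L2_on_def)
qed

lemma L2_on_inner_mult:
  fixes f :: "'a::euclidean_space \<Rightarrow> real"
  assumes "L2_on D f" "open D" "bounded D"
  shows "L2_on D (\<lambda>x. f x * (x \<bullet> b))"
proof -
  have [measurable]: "f \<in> borel_measurable (lebesgue_on D)" using assms by (simp add: L2_on_def)
  have [measurable]: "(\<lambda>x. x \<bullet> b) \<in> borel_measurable (lebesgue_on D)"
    by (intro measurable_lebesgue_on_continuous continuous_intros)
  obtain B where B: "\<And>x. x \<in> D \<Longrightarrow> norm x \<le> B" using assms(3) by (meson bounded_iff)
  have "integrable (lebesgue_on D) (\<lambda>x. (norm (f x * (x \<bullet> b)))\<^sup>2)"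
  proof (rule Bochner_Integration.integrable_bound)
    show "integrable (lebesgue_on D) (\<lambda>x. (B * norm b)\<^sup>2 * (norm (f x))\<^sup>2)"
      using assms by (simp add: L2_on_def)
    have "(norm (f x * (x \<bullet> b)))\<^sup>2 \<le> (B * norm b)\<^sup>2 * (norm (f x))\<^sup>2" if "x \<in> D" for x
    proof -
      have "\<bar>x \<bullet> b\<bar> \<le> B * norm b"
        using Cauchy_Schwarz_ineq2[of x b] B[OF that] by (meson mult_right_mono norm_ge_zero order_trans)
      then have "(x \<bullet> b)\<^sup>2 \<le> (B * norm b)\<^sup>2" by (metis abs_ge_zero power2_abs power_mono)
      then show ?thesis by (simp add: power_mult_distrib mult.commute mult_left_mono)
    qed
    then show "AE x in lebesgue_on D. norm ((norm (f x * (x \<bullet> b)))\<^sup>2) \<le> norm ((B * norm b)\<^sup>2 * (norm (f x))\<^sup>2)"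
      by (auto intro!: AE_I2 simp: power_mult_distrib)
  qed measurable
  then show ?thesis by (simp add: L2_on_def)
qed

lemma L2_on_add:
  assumes "L2_on D f" "L2_on D g"
  shows "L2_on D (\<lambda>x. f x + g x)"
proof -
  have [measurable]: "f \<in> borel_measurable (lebesgue_on D)" "g \<in> borel_measurable (lebesgue_on D)"
    using assms by (auto simp: L2_on_def)
  have "integrable (lebesgue_on D) (\<lambda>x. (norm (f x + g x))\<^sup>2)"
  proof (rule Bochner_Integration.integrable_bound)
    show "integrable (lebesgue_on D) (\<lambda>x. 2 * (norm (f x))\<^sup>2 + 2 * (norm (g x))\<^sup>2)"
      using assms by (auto simp: L2_on_def)
    have "(norm (a + b))\<^sup>2 \<le> 2 * (norm a)\<^sup>2 + 2 * (norm b)\<^sup>2" for a b :: 'b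
      using zero_le_power2[of "norm (a - b)"]
      by (simp add: power2_norm_eq_inner inner_add_left inner_add_right inner_diff_left inner_diff_right inner_commute)
    then show "AE x in lebesgue_on D. norm ((norm (f x + g x))\<^sup>2) \<le> norm (2 * (norm (f x))\<^sup>2 + 2 * (norm (g x))\<^sup>2)"
      by simp
  qed measurable
  then show ?thesis by (simp add: L2_on_def)
qed

lemma L2_on_scaleR: "L2_on D f \<Longrightarrow> L2_on D (\<lambda>x. c *\<^sub>R f x)"
  by (auto simp: L2_on_def power_mult_distrib)

lemma L2_on_diff: "L2_on D f \<Longrightarrow> L2_on D g \<Longrightarrow> L2_on D (\<lambda>x. f x - g x)"
  using L2_on_add[of D f "\<lambda>x. (-1) *\<^sub>R g x"] L2_on_scaleR[of D g "-1"] by simp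

lemma L2_on_sum:
  assumes "finite I" "\<And>i. i \<in> I \<Longrightarrow> L2_on D (f i)"
  shows "L2_on D (\<lambda>x. \<Sum>i\<in>I. f i x)"
  using assms
proof (induction I rule: finite_induct)
  case (insert i I)
  then show ?case by (simp add: L2_on_add)
qed (simp add: L2_on_def)

lemma L2_on_inner:
  assumes "L2_on D g"
  shows "L2_on D (\<lambda>x. g x \<bullet> b)"
proof -
  have [measurable]: "g \<in> borel_measurable (lebesgue_on D)" using assms by (auto simp: L2_on_def)
  have "integrable (lebesgue_on D) (\<lambda>x. (norm (g x \<bullet> b))\<^sup>2)"
  proof (rule Bochner_Integration.integrable_bound)
    show "integrable (lebesgue_on D) (\<lambda>x. (norm b)\<^sup>2 * (norm (g x))\<^sup>2)"
      using assms by (auto simp: L2_on_def)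
    show "AE x in lebesgue_on D. norm ((norm (g x \<bullet> b))\<^sup>2) \<le> norm ((norm b)\<^sup>2 * (norm (g x))\<^sup>2)"
      using Cauchy_Schwarz_ineq[of _ b] by (auto simp: power2_norm_eq_inner mult.commute[of "b \<bullet> b"])
  qed measurable
  then show ?thesis by (simp add: L2_on_def)
qed

lemma L2_on_integrable_mult:
  fixes f g :: "'a::euclidean_space \<Rightarrow> real"
  shows "L2_on D f \<Longrightarrow> L2_on D g \<Longrightarrow> integrable (lebesgue_on D) (\<lambda>x. f x * g x)"
  by (auto simp: L2_on_def intro: integrable_mult_of_squares)

text \<open>The test functions \<open>x\<^sub>b \<psi>\<^sub>n\<close>, with \<open>\<psi>\<^sub>n\<close> approximating \<open>\<phi>\<close>, replace Poincare's inequality.\<close>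

lemma weak_grad_zero_pairing:
  fixes D :: "'a::euclidean_space set"
  assumes D: "open D" "bounded D" and f: "L2_on D f" and b: "b \<in> Basis" and \<phi>: "\<phi> \<in> H10 D"
    and zero: "\<And>\<eta>. test_function D \<eta> \<Longrightarrow> (LINT x|lebesgue_on D. f x * frechet_derivative \<eta> (at x) b) = 0"
  shows "(LINT x|lebesgue_on D. f x * \<phi> x) =
     - (LINT x|lebesgue_on D. (f x * (x \<bullet> b)) * (weak_grad D \<phi> x \<bullet> b))"
proof -
  let ?M = "lebesgue_on D" and ?g = "weak_grad D \<phi>"
  have L2: "L2_on D \<phi>" "L2_on D ?g" using \<phi> by (auto simp: H10_def has_weak_grad_def)
  obtain \<psi> where \<psi>: "\<And>n::nat. test_function D (\<psi> n)"
    "(\<lambda>n. LINT x|?M. (\<psi> n x - \<phi> x)\<^sup>2) \<longlonglongrightarrow> 0"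
    "(\<lambda>n. LINT x|?M. (norm (classical_grad (\<psi> n) x - ?g x))\<^sup>2) \<longlonglongrightarrow> 0"
    using \<phi> by (auto simp: H10_def)
  have L2\<psi>: "L2_on D (\<psi> n)" "L2_on D (classical_grad (\<psi> n))" for n
    using \<psi>(1)[of n] D by (auto intro!: L2_on_continuous test_function_continuous continuous_on_classical_grad)
  define F where "F x = f x * (x \<bullet> b)" for x
  have F: "L2_on D F" using f D unfolding F_def by (rule L2_on_inner_mult)
  \<comment> \<open>h and k are the errors of the approximating test functions and of their
    b-derivatives. Both tend to zero in L2, so their pairings with the fixed functions f and F
    vanish in the limit.\<close>
  define h where "h n x = \<psi> n x - \<phi> x" for n x
  define k where "k n x = (classical_grad (\<psi> n) x - ?g x) \<bullet> b" for n x
  have h: "L2_on D (h n)" and k: "L2_on D (k n)" for n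
    unfolding h_def k_def by (intro L2_on_diff L2_on_inner L2\<psi> L2)+
  have h0: "(\<lambda>n. LINT x|?M. f x * h n x) \<longlonglongrightarrow> 0"
    using f h \<psi>(2)[folded h_def] by (intro integral_mult_tendsto_0) (auto simp: L2_on_def)
  have "(\<lambda>n. LINT x|?M. (k n x)\<^sup>2) \<longlonglongrightarrow> 0"
  proof (rule tendsto_sandwich[OF _ _ tendsto_const \<psi>(3)])
    have "(LINT x|?M. (k n x)\<^sup>2) \<le> (LINT x|?M. (norm (classical_grad (\<psi> n) x - ?g x))\<^sup>2)" for n
    proof (rule integral_mono)
      show "(k n x)\<^sup>2 \<le> (norm (classical_grad (\<psi> n) x - ?g x))\<^sup>2" for x
        using Basis_le_norm[OF b, of "classical_grad (\<psi> n) x - ?g x"]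
        by (metis k_def abs_ge_zero power2_abs power_mono)
    qed (use k[of n] L2_on_diff[OF L2\<psi>(2)[of n] L2(2)] in \<open>auto simp: L2_on_def\<close>)
    then show "\<forall>\<^sub>F n in sequentially. (LINT x|?M. (k n x)\<^sup>2) \<le>
        (LINT x|?M. (norm (classical_grad (\<psi> n) x - ?g x))\<^sup>2)" by simp
  qed auto
  then have k0: "(\<lambda>n. LINT x|?M. F x * k n x) \<longlonglongrightarrow> 0"
    using F k by (intro integral_mult_tendsto_0) (auto simp: L2_on_def)
  note int = L2_on_integrable_mult
  \<comment> \<open>The hypothesis \<open>zero\<close> is applied to x_b times
    \<open>\<psi> n\<close>, whose b-derivative is \<open>\<psi> n\<close> plus x_b times the
    b-derivative of \<open>\<psi> n\<close>. Splitting off h and k gives an identity that is exact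
    for every n, and the claim is its limit.\<close>
  have "(LINT x|?M. f x * h n x) + (LINT x|?M. f x * \<phi> x) +
     ((LINT x|?M. F x * k n x) + (LINT x|?M. F x * (?g x \<bullet> b))) = 0" for n
  proof -
    have der: "frechet_derivative (\<lambda>x. (x \<bullet> b) * \<psi> n x) (at x) b = \<psi> n x + (x \<bullet> b) * (classical_grad (\<psi> n) x \<bullet> b)" for x
    proof -
      have "((\<lambda>x. (x \<bullet> b) * \<psi> n x) has_derivative
          (\<lambda>h. (h \<bullet> b) * \<psi> n x + (x \<bullet> b) * frechet_derivative (\<psi> n) (at x) h)) (at x)"
        by (intro has_derivative_inner_mult test_function_differentiable[OF \<psi>(1)])
      from frechet_derivative_at[OF this, symmetric] b show ?thesis
        by (simp add: classical_grad_inner_Basis)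
    qed
    have "(LINT x|?M. f x * h n x) + (LINT x|?M. f x * \<phi> x) +
     ((LINT x|?M. F x * k n x) + (LINT x|?M. F x * (?g x \<bullet> b))) =
       (LINT x|?M. (f x * h n x + f x * \<phi> x) + (F x * k n x + F x * (?g x \<bullet> b)))"
      using int[OF f h[of n]] int[OF f L2(1)] int[OF F k[of n]] int[OF F L2_on_inner[OF L2(2)]] by simp
    also have "\<dots> = (LINT x|?M. f x * frechet_derivative (\<lambda>x. (x \<bullet> b) * \<psi> n x) (at x) b)"
      by (intro Bochner_Integration.integral_cong refl)
         (simp add: der h_def k_def F_def inner_diff_left algebra_simps)
    also have "\<dots> = 0" by (intro zero test_function_inner_mult \<psi>)
    finally show ?thesis .
  qed
  moreover have "(\<lambda>n. (LINT x|?M. f x * h n x) + (LINT x|?M. f x * \<phi> x) +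
     ((LINT x|?M. F x * k n x) + (LINT x|?M. F x * (?g x \<bullet> b)))) \<longlonglongrightarrow>
     0 + (LINT x|?M. f x * \<phi> x) + (0 + (LINT x|?M. F x * (?g x \<bullet> b)))"
    by (intro tendsto_intros h0 k0)
  ultimately have "0 + (LINT x|?M. f x * \<phi> x) + (0 + (LINT x|?M. F x * (?g x \<bullet> b))) = 0"
    by (simp add: LIMSEQ_const_iff)
  then show ?thesis by (simp add: F_def)
qed

text \<open>One vanishing partial derivative is enough. The pairing lemma is applied to each
  \<open>\<phi> i\<close> against the whole combination f; summing with the weights c expresses the
  integral of f^2 through the vanishing derivative. This way neither membership of f in
  \<open>H10\<close> nor linearity of the chosen \<open>weak_grad\<close> has to be
  established.\<close>

lemma H10_combination_zero_grad:
  fixes D :: "'a::euclidean_space set" and \<phi> :: "'n::finite \<Rightarrow> 'a \<Rightarrow> real"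
  assumes D: "open D" "bounded D" and \<phi>: "\<And>i. \<phi> i \<in> H10 D" and b: "b \<in> Basis"
    and grad: "AE x in lebesgue_on D. (\<Sum>i\<in>UNIV. c i * (weak_grad D (\<phi> i) x \<bullet> b)) = 0"
  shows "AE x in lebesgue_on D. (\<Sum>i\<in>UNIV. c i * \<phi> i x) = 0"
proof -
  let ?M = "lebesgue_on D"
  have L2: "L2_on D (\<phi> i)" "L2_on D (weak_grad D (\<phi> i))" for i
    using \<phi>[of i] by (auto simp: H10_def has_weak_grad_def)
  have wg: "(LINT x|?M. \<phi> i x * frechet_derivative \<eta> (at x) b) = - (LINT x|?M. (weak_grad D (\<phi> i) x \<bullet> b) * \<eta> x)"
    if "test_function D \<eta>" for i \<eta>
    using \<phi>[of i] b that by (auto simp: H10_def has_weak_grad_def)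
  define f where "f x = (\<Sum>i\<in>UNIV. c i * \<phi> i x)" for x
  have f: "L2_on D f"
    unfolding f_def using L2_on_scaleR[OF L2(1)] by (intro L2_on_sum) auto
  have zero: "(LINT x|?M. f x * frechet_derivative \<eta> (at x) b) = 0" if \<eta>: "test_function D \<eta>" for \<eta>
  proof -
    have L2\<eta>: "L2_on D \<eta>" "L2_on D (\<lambda>x. frechet_derivative \<eta> (at x) b)"
      using \<eta> b D test_function_continuous_deriv[OF \<eta> b]
      by (auto intro!: L2_on_continuous intro: test_function_continuous)
    have "(LINT x|?M. f x * frechet_derivative \<eta> (at x) b) =
        (\<Sum>i\<in>UNIV. c i * (LINT x|?M. \<phi> i x * frechet_derivative \<eta> (at x) b))"
      using L2_on_integrable_mult[OF L2(1) L2\<eta>(2)] by (simp add: f_def sum_distrib_right mult.assoc)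
    also have "\<dots> = - (LINT x|?M. (\<Sum>i\<in>UNIV. c i * (weak_grad D (\<phi> i) x \<bullet> b)) * \<eta> x)"
      using L2_on_integrable_mult[OF L2_on_inner[OF L2(2)] L2\<eta>(1), of _ b]
      by (simp add: wg[OF \<eta>] sum_distrib_right mult.assoc sum_negf)
    also have "(LINT x|?M. (\<Sum>i\<in>UNIV. c i * (weak_grad D (\<phi> i) x \<bullet> b)) * \<eta> x) = 0"
      using grad by (intro integral_eq_zero_AE) auto
    finally show ?thesis by simp
  qed
  define F where "F x = f x * (x \<bullet> b)" for x
  have F: "L2_on D F" using f D unfolding F_def by (rule L2_on_inner_mult)
  have "f x * f x = (\<Sum>i\<in>UNIV. c i * (f x * \<phi> i x))" for x
    by (subst (2) f_def) (simp add: sum_distrib_left mult.left_commute)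
  then have "(LINT x|?M. (f x)\<^sup>2) = (\<Sum>i\<in>UNIV. c i * (LINT x|?M. f x * \<phi> i x))"
    using L2_on_integrable_mult[OF f L2(1)] by (simp add: power2_eq_square)
  also have "\<dots> = - (\<Sum>i\<in>UNIV. c i * (LINT x|?M. F x * (weak_grad D (\<phi> i) x \<bullet> b)))"
    using weak_grad_zero_pairing[OF D f b \<phi> zero] by (simp add: sum_negf F_def)
  also have "(\<Sum>i\<in>UNIV. c i * (LINT x|?M. F x * (weak_grad D (\<phi> i) x \<bullet> b))) =
      (LINT x|?M. F x * (\<Sum>i\<in>UNIV. c i * (weak_grad D (\<phi> i) x \<bullet> b)))"
    using L2_on_integrable_mult[OF F L2_on_inner[OF L2(2)]]
    by (simp add: sum_distrib_left mult.left_commute[of "F _"])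
  also have "\<dots> = 0" using grad by (intro integral_eq_zero_AE) auto
  finally have "AE x in ?M. (f x)\<^sup>2 = 0"
    using f by (simp add: integral_nonneg_eq_0_iff_AE L2_on_def)
  then show ?thesis by (simp add: f_def)
qed

subsection \<open>Kronecker products and the mass norm\<close>

lemma matrix_inv_apply:
  assumes "invertible A"
  shows "matrix_inv A *v (A *v x) = x" "A *v (matrix_inv A *v x) = x"
proof -
  have "A ** matrix_inv A = mat 1 \<and> matrix_inv A ** A = mat 1"
    using assms unfolding invertible_def matrix_inv_def by (rule someI_ex)
  then show "matrix_inv A *v (A *v x) = x" "A *v (matrix_inv A *v x) = x"
    by (simp_all add: matrix_vector_mul_assoc)
qed

lemma invertible_if_trivial_kernel:
  fixes A :: "real^'n^'n"
  assumes "\<And>x. A *v x = 0 \<Longrightarrow> x = 0"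
  shows "invertible A"
  using assms by (simp add: invertible_left_inverse matrix_left_invertible_ker)

lemma sum_prod_UNIV: "(\<Sum>a\<in>UNIV. f a) = (\<Sum>p\<in>UNIV. \<Sum>i\<in>UNIV. f (p, i))"
  for f :: "'p::finite \<times> 'n::finite \<Rightarrow> 'b::comm_monoid_add"
  by (simp add: sum.cartesian_product flip: UNIV_Times_UNIV)

lemma kron_mult_vec:
  "((X \<otimes>\<^sub>K Y) *v v) $ (p, i) = (\<Sum>q\<in>UNIV. \<Sum>j\<in>UNIV. X $ p $ q * Y $ i $ j * v $ (q, j))"
  by (simp add: matrix_vector_mult_def kron_def sum_prod_UNIV)

lemma kron_sum_right: "X \<otimes>\<^sub>K (\<Sum>m\<in>I. Y m) = (\<Sum>m\<in>I. X \<otimes>\<^sub>K Y m)"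
  by (simp add: vec_eq_iff kron_def sum_distrib_left)

lemma sum_matrix_vector_mult:
  fixes X :: "'i \<Rightarrow> real^'n^'m"
  shows "(\<Sum>m\<in>I. X m) *v v = (\<Sum>m\<in>I. X m *v v)"
  by (induction I rule: infinite_finite_induct) (auto simp: matrix_vector_mult_add_rdistrib)

lemma kron_form:
  "v \<bullet> ((X \<otimes>\<^sub>K Y) *v w) =
    (\<Sum>p\<in>UNIV. \<Sum>q\<in>UNIV. \<Sum>i\<in>UNIV. \<Sum>j\<in>UNIV. X $ p $ q * (v $ (p, i) * w $ (q, j) * Y $ i $ j))"
  (is "?l = ?r")
proof -
  have "?l = (\<Sum>p\<in>UNIV. \<Sum>i\<in>UNIV. \<Sum>q\<in>UNIV. \<Sum>j\<in>UNIV. X $ p $ q * (v $ (p, i) * w $ (q, j) * Y $ i $ j))"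
    by (simp add: inner_vec_def sum_prod_UNIV kron_mult_vec sum_distrib_left mult_ac)
  also have "\<dots> = ?r" by (intro sum.cong refl sum.swap)
  finally show ?thesis .
qed

lemma kron_form_symmetric:
  fixes X :: "real^'p::finite^'p" and Y :: "real^'n::finite^'n"
  assumes "transpose X = X" "transpose Y = Y"
  shows "v \<bullet> ((X \<otimes>\<^sub>K Y) *v w) = w \<bullet> ((X \<otimes>\<^sub>K Y) *v v)"
proof -
  have "X $ p $ q = X $ q $ p" for p q using assms(1) by (metis transpose_def vec_lambda_beta)
  moreover have "Y $ i $ j = Y $ j $ i" for i j using assms(2) by (metis transpose_def vec_lambda_beta)
  ultimately have "transpose (X \<otimes>\<^sub>K Y) = X \<otimes>\<^sub>K Y"
    by (simp add: vec_eq_iff kron_def transpose_def)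
  then show ?thesis by (metis dot_lmul_matrix inner_commute vector_transpose_matrix)
qed

text \<open>The function with values in R^P that a coefficient vector represents at the point x. The
  family h is either the finite element basis or one directional derivative of it.\<close>

definition field_value :: "('n::finite \<Rightarrow> 'a \<Rightarrow> real) \<Rightarrow> real^('p::finite \<times> 'n) \<Rightarrow> 'a \<Rightarrow> real^'p" where
  "field_value h v x = (\<chi> p. \<Sum>i\<in>UNIV. v $ (p, i) * h i x)"

lemma field_value_form:
  "field_value h v x \<bullet> (X *v field_value h w x) =
    (\<Sum>p\<in>UNIV. \<Sum>q\<in>UNIV. \<Sum>i\<in>UNIV. \<Sum>j\<in>UNIV. X $ p $ q * (v $ (p, i) * w $ (q, j) * (h i x * h j x)))"
proof -
  have "field_value h v x \<bullet> (X *v field_value h w x) =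
     (\<Sum>p\<in>UNIV. \<Sum>q\<in>UNIV. X $ p $ q * ((\<Sum>i\<in>UNIV. v $ (p, i) * h i x) * (\<Sum>j\<in>UNIV. w $ (q, j) * h j x)))"
    by (simp add: inner_vec_def matrix_vector_mult_def field_value_def sum_distrib_left[of "sum _ _"] mult_ac)
  also have "\<dots> = (\<Sum>p\<in>UNIV. \<Sum>q\<in>UNIV. \<Sum>i\<in>UNIV. \<Sum>j\<in>UNIV. X $ p $ q * (v $ (p, i) * w $ (q, j) * (h i x * h j x)))"
    unfolding sum_product by (simp add: sum_distrib_left mult_ac)
  finally show ?thesis .
qed

text \<open>When Y is a weighted Gram matrix of h, the Kronecker form turns into an integral of the
  small form X acting on field values. Bounds for X can then be applied pointwise in x, for mass and
  stiffness matrices alike.\<close>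

lemma kron_form_integral:
  fixes h :: "'n::finite \<Rightarrow> 'a \<Rightarrow> real" and v w :: "real^('p::finite \<times> 'n)"
  assumes "\<And>i j. integrable \<mu> (\<lambda>x. a x * (h i x * h j x))"
    and Y: "\<And>i j. Y $ i $ j = (LINT x|\<mu>. a x * (h i x * h j x))"
  shows "v \<bullet> ((X \<otimes>\<^sub>K Y) *v w) = (LINT x|\<mu>. a x * (field_value h v x \<bullet> (X *v field_value h w x)))"
    and "integrable \<mu> (\<lambda>x. a x * (field_value h v x \<bullet> (X *v field_value h w x)))"
proof -
  have eq: "a x * (field_value h v x \<bullet> (X *v field_value h w x)) =
    (\<Sum>p\<in>UNIV. \<Sum>q\<in>UNIV. \<Sum>i\<in>UNIV. \<Sum>j\<in>UNIV. X $ p $ q * (v $ (p, i) * w $ (q, j) * (a x * (h i x * h j x))))" for x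
    unfolding field_value_form by (simp add: sum_distrib_left mult_ac)
  show "integrable \<mu> (\<lambda>x. a x * (field_value h v x \<bullet> (X *v field_value h w x)))"
    unfolding eq
    by (intro Bochner_Integration.integrable_sum Bochner_Integration.integrable_mult_right assms)
  show "v \<bullet> ((X \<otimes>\<^sub>K Y) *v w) = (LINT x|\<mu>. a x * (field_value h v x \<bullet> (X *v field_value h w x)))"
    unfolding eq kron_form Y
    by (simp add: Bochner_Integration.integral_sum Bochner_Integration.integrable_sum assms)
qed

lemma kron_mat1_apply:
  "((X \<otimes>\<^sub>K mat 1) *v v) $ (p, i) = (\<Sum>q\<in>UNIV. X $ p $ q * v $ (q, i))"
  by (simp add: kron_mult_vec mat_def if_distrib if_distribR cong: if_cong)

lemma field_value_kron_mat1:
  "field_value h ((X \<otimes>\<^sub>K mat 1) *v v) x = X *v field_value h v x"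
proof -
  have "field_value h ((X \<otimes>\<^sub>K mat 1) *v v) x $ p = (X *v field_value h v x) $ p" for p
    by (simp add: kron_mat1_apply field_value_def)
       (simp add: matrix_vector_mult_def sum_distrib_left sum_distrib_right mult_ac, rule sum.swap)
  then show ?thesis by (simp add: vec_eq_iff)
qed

lemma kron_mat1_mult:
  "(X \<otimes>\<^sub>K mat 1) *v ((Y \<otimes>\<^sub>K mat 1) *v (v :: real^('p::finite \<times> 'n::finite))) = ((X ** Y) \<otimes>\<^sub>K mat 1) *v v"
proof -
  have "((X \<otimes>\<^sub>K mat 1) *v ((Y \<otimes>\<^sub>K mat 1) *v v)) $ (p, i) = (((X ** Y) \<otimes>\<^sub>K mat 1) *v v) $ (p, i)" for p i
    by (simp add: kron_mat1_apply)
       (simp add: matrix_matrix_mult_def sum_distrib_left sum_distrib_right mult_ac, rule sum.swap)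
  then show ?thesis by (simp add: vec_eq_iff split_paired_all)
qed

lemma kron_mat1_mat1: "mat 1 \<otimes>\<^sub>K mat 1 = mat 1"
  by (auto simp: vec_eq_iff kron_def mat_def prod_eq_iff)

lemma M_hat_form: "v \<bullet> (M_hat M *v v) = (\<Sum>p\<in>UNIV. \<Sum>i\<in>UNIV. \<Sum>j\<in>UNIV. v $ (p, i) * M $ i $ j * v $ (p, j))"
proof -
  have "v \<bullet> (M_hat M *v v) = (\<Sum>p\<in>UNIV. \<Sum>q\<in>UNIV. if p = q then (\<Sum>i\<in>UNIV. \<Sum>j\<in>UNIV. v $ (p, i) * v $ (q, j) * M $ i $ j) else 0)"
    unfolding M_hat_def kron_form by (intro sum.cong refl) (auto simp: mat_def)
  also have "\<dots> = (\<Sum>p\<in>UNIV. \<Sum>i\<in>UNIV. \<Sum>j\<in>UNIV. v $ (p, i) * M $ i $ j * v $ (p, j))"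
    by (simp add: mult_ac)
  finally show ?thesis .
qed

lemma M_norm_eq: "M_norm M v = sqrt (v \<bullet> (M_hat M *v v))"
  by (simp add: M_norm_def M_hat_form)

lemma transpose_mat1: "transpose (mat 1) = mat 1"
  by (simp add: vec_eq_iff transpose_def mat_def)

section \<open>The norm induced by the mass matrix\<close>

context
  fixes M :: "real^'n::finite^'n"
  assumes sym: "transpose M = M"
    and pos: "\<And>v :: real^('p::finite \<times> 'n). v \<noteq> 0 \<Longrightarrow> v \<bullet> (M_hat M *v v) > 0"
begin

lemma M_form_nonneg: "v \<bullet> (M_hat M *v v) \<ge> 0" for v :: "real^('p \<times> 'n)"
  using pos[of v] by (cases "v = 0") auto

lemma M_hat_invertible: "invertible (M_hat M :: real^('p \<times> 'n)^('p \<times> 'n))"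
  using pos by (intro invertible_if_trivial_kernel) fastforce

text \<open>Cauchy-Schwarz for the mass form follows from the nonnegativity of the form at v + t w
  for all t.\<close>

lemma M_norm_triangle: "M_norm M (v + w) \<le> M_norm M v + M_norm M w" for v w :: "real^('p \<times> 'n)"
proof -
  define b where "b v w = v \<bullet> (M_hat M *v w)" for v w :: "real^('p \<times> 'n)"
  have b_sym: "b v w = b w v" for v w
    unfolding b_def M_hat_def by (intro kron_form_symmetric sym transpose_mat1)
  have b_add: "b (v + t *\<^sub>R w) (v + t *\<^sub>R w) = b v v + 2 * t * b v w + t\<^sup>2 * b w w" for v w t
    using b_sym[of w v]
    by (simp add: b_def inner_add_left inner_add_right matrix_vector_right_distrib
      matrix_vector_mult_scaleR power2_eq_square algebra_simps)
  have nonneg: "b v v \<ge> 0" for v unfolding b_def by (rule M_form_nonneg)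
  have "(b v w)\<^sup>2 \<le> b v v * b w w"
    using nonneg[of "v + _ *\<^sub>R w"] nonneg[of w] by (intro discriminant_le) (auto simp: b_add)
  then have "b v w \<le> sqrt (b v v) * sqrt (b w w)"
    by (metis real_le_rsqrt real_sqrt_mult)
  then have "b (v + w) (v + w) \<le> (sqrt (b v v) + sqrt (b w w))\<^sup>2"
    using b_add[of v 1 w] nonneg[of v] nonneg[of w] by (simp add: power2_sum)
  then show ?thesis
    unfolding M_norm_eq b_def[symmetric] using nonneg by (intro real_le_lsqrt) auto
qed

text \<open>The constant is the minimum of the mass norm on the Euclidean unit sphere: attained by
  compactness, positive by definiteness, and extended to all vectors by homogeneity.\<close>

lemma M_norm_equiv_norm:
  obtains c where "c > 0" "\<And>v :: real^('p \<times> 'n). c * norm v \<le> M_norm M v"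
proof -
  let ?S = "sphere 0 1 :: (real^('p \<times> 'n)) set"
  have cont: "continuous_on ?S (M_norm M)"
    unfolding M_norm_eq[abs_def]
    by (intro continuous_intros linear_continuous_on_compose[OF continuous_on_id]) auto
  obtain e where "e \<in> ?S" using vector_choose_size[of 1] by (auto simp: dist_norm)
  then obtain v0 where v0: "v0 \<in> ?S" "\<And>v. v \<in> ?S \<Longrightarrow> M_norm M v0 \<le> M_norm M v"
    using continuous_attains_inf[OF compact_sphere _ cont] by blast
  have scale: "M_norm M (t *\<^sub>R v) = \<bar>t\<bar> * M_norm M v" for t and v :: "real^('p \<times> 'n)"
    by (simp add: M_norm_eq matrix_vector_mult_scaleR real_sqrt_mult flip: mult.assoc)
  show thesis
  proof
    show "M_norm M v0 > 0" using v0(1) pos[of v0] by (cases "v0 = 0") (auto simp: M_norm_eq)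
    show "M_norm M v0 * norm v \<le> M_norm M v" for v :: "real^('p \<times> 'n)"
    proof (cases "v = 0")
      case False
      then have "M_norm M v0 \<le> M_norm M (v /\<^sub>R norm v)" by (intro v0(2)) simp
      then show ?thesis using False by (simp add: scale field_simps)
    qed (simp add: M_norm_eq)
  qed
qed

lemma M_norm_le_norm:
  obtains c where "c > 0" "\<And>v :: real^('p \<times> 'n). M_norm M v \<le> c * norm v"
proof -
  obtain c where c: "c > 0" "\<And>v :: real^('p \<times> 'n). norm (M_hat M *v v) \<le> norm v * c"
    using bounded_linear.pos_bounded[OF matrix_vector_mul_bounded_linear[of "M_hat M :: real^('p \<times> 'n)^('p \<times> 'n)"]]
    by auto
  have "M_norm M v \<le> sqrt c * norm v" for v :: "real^('p \<times> 'n)"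
  proof -
    have "v \<bullet> (M_hat M *v v) \<le> norm v * (norm v * c)"
      using norm_cauchy_schwarz[of v "M_hat M *v v"] c(2)[of v]
      by (meson mult_left_mono norm_ge_zero order_trans)
    then show ?thesis unfolding M_norm_eq
      by (intro real_le_lsqrt) (use c in \<open>auto simp: power_mult_distrib power2_eq_square[of "norm v"] mult_ac\<close>)
  qed
  then show thesis using c(1) by (intro that[of "sqrt c"]) auto
qed

text \<open>The supremum in \<open>M_onorm\<close> is informative only once its set of ratios is
  known to be bounded above; the two norm comparisons provide this bound.\<close>

lemma M_onorm_bound:
  fixes f :: "real^('p \<times> 'n) \<Rightarrow> real^('p \<times> 'n)"
  assumes "linear f"
  shows "M_norm M (f w) \<le> M_onorm M f * M_norm M w"
proof -
  obtain c where c: "c > 0" "\<And>v :: real^('p \<times> 'n). c * norm v \<le> M_norm M v"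
    by (rule M_norm_equiv_norm) blast
  obtain C where C: "C > 0" "\<And>v :: real^('p \<times> 'n). M_norm M v \<le> C * norm v"
    by (rule M_norm_le_norm) blast
  obtain B where B: "\<And>v. norm (f v) \<le> B * norm v" "B > 0"
    using linear_bounded_pos[OF assms] by blast
  have nonneg: "M_norm M v \<ge> 0" for v :: "real^('p \<times> 'n)"
    by (simp add: M_norm_eq M_form_nonneg)
  \<comment> \<open>The supremum also ranges over the zero vector, where the ratio is 0 by the
    convention for division by zero.\<close>
  have ratio: "M_norm M (f v) / M_norm M v \<le> C * B / c" for v
  proof (cases "v = 0")
    case False
    then have "M_norm M v > 0" using pos by (simp add: M_norm_eq)
    moreover have "M_norm M (f v) \<le> C * (B * norm v)"
      using C(2)[of "f v"] B(1)[of v] C(1) by (meson mult_left_mono less_imp_le order_trans)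
    moreover have "C * B * (c * norm v) \<le> C * B * M_norm M v"
      using c(2)[of v] C(1) B(2) by (intro mult_left_mono) auto
    ultimately show ?thesis using c(1) by (simp add: divide_simps mult_ac)
       (smt (verit) mult_left_mono mult_ac)
  qed (use C B c in \<open>simp add: M_norm_eq\<close>)
  show ?thesis
  proof (cases "w = 0")
    case True
    then show ?thesis using linear_0[OF assms] by (simp add: M_norm_eq)
  next
    case False
    then have "M_norm M w > 0" using pos by (simp add: M_norm_eq)
    moreover have "M_norm M (f w) / M_norm M w \<le> M_onorm M f"
      unfolding M_onorm_def by (rule cSUP_upper) (auto intro!: bdd_aboveI2 ratio)
    ultimately show ?thesis by (simp add: divide_simps)
  qed
qed

end

subsection \<open>Invertibility of the Galerkin matrices\<close>

lemma Linfty_on_AE_bound: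
  assumes "Linfty_on D a"
  obtains C where "AE x in lebesgue_on D. \<bar>a x\<bar> \<le> C"
proof -
  obtain C where C: "Linfty_norm D a \<le> ereal C"
    using assms by (cases "Linfty_norm D a") (auto simp: Linfty_on_def)
  have "AE x in lebesgue_on D. ereal \<bar>a x\<bar> \<le> Linfty_norm D a"
    unfolding Linfty_norm_def by (rule esssup_AE)
  then have "AE x in lebesgue_on D. \<bar>a x\<bar> \<le> C"
    by eventually_elim (use C order_trans in fastforce)
  then show thesis by (rule that)
qed

lemma Linfty_on_integrable_mult:
  fixes f :: "'a::euclidean_space \<Rightarrow> real"
  assumes "Linfty_on D a" "integrable (lebesgue_on D) f"
  shows "integrable (lebesgue_on D) (\<lambda>x. a x * f x)"
proof -
  obtain C where C: "AE x in lebesgue_on D. \<bar>a x\<bar> \<le> C" using assms(1) by (rule Linfty_on_AE_bound)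
  have [measurable]: "a \<in> borel_measurable (lebesgue_on D)" "f \<in> borel_measurable (lebesgue_on D)"
    using assms by (auto simp: Linfty_on_def)
  show ?thesis
  proof (rule Bochner_Integration.integrable_bound)
    show "integrable (lebesgue_on D) (\<lambda>x. C * f x)" using assms(2) by simp
    show "AE x in lebesgue_on D. norm (a x * f x) \<le> norm (C * f x)"
      using C
    proof eventually_elim
      case (elim x)
      then have "\<bar>a x\<bar> * \<bar>f x\<bar> \<le> \<bar>C\<bar> * \<bar>f x\<bar>" by (intro mult_right_mono) auto
      then show ?case by (simp add: abs_mult)
    qed
  qed measurable
qed

text \<open>Countably many essential bounds hold simultaneously off a null set, and there the
  partial sum lies below the series of norms. Strictness is kept, since it later forces the energy
  density to vanish.\<close>

lemma AE_coefficient_dominance: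
  assumes "(\<Sum>m. Linfty_norm D (a (Suc m))) < ess_inf_on D (a 0)"
  shows "AE x in lebesgue_on D. (\<Sum>m<N. \<bar>a (Suc m) x\<bar>) < a 0 x"
proof -
  define L where "L m = Linfty_norm D (a (Suc m))" for m
  have L: "AE x in lebesgue_on D. ereal \<bar>a (Suc m) x\<bar> \<le> L m" for m
    unfolding Linfty_norm_def L_def by (rule esssup_AE)
  have a0: "AE x in lebesgue_on D. ereal (- a 0 x) \<le> - ess_inf_on D (a 0)"
    unfolding ess_inf_on_def using esssup_AE[of "\<lambda>x. ereal (- a 0 x)" "lebesgue_on D"] by simp
  show ?thesis
  \<comment> \<open>Bounding a partial sum by the series requires nonnegative terms. A negative
    essential supremum of an absolute value occurs only for a null set D, where almost everywhere
    statements are vacuous.\<close>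
  proof (cases "\<forall>m. L m \<ge> 0")
    case True
    have "AE x in lebesgue_on D. \<forall>m. ereal \<bar>a (Suc m) x\<bar> \<le> L m" using L by (simp add: AE_all_countable)
    then show ?thesis using a0
    proof eventually_elim
      case (elim x)
      have "ereal (\<Sum>m<N. \<bar>a (Suc m) x\<bar>) \<le> (\<Sum>m<N. L m)"
        unfolding sum_ereal[symmetric] using elim(1) by (intro sum_mono) auto
      also have "\<dots> \<le> (\<Sum>m. L m)" using True by (intro suminf_upper) auto
      also have "\<dots> < ess_inf_on D (a 0)" using assms by (simp add: L_def)
      also have "\<dots> \<le> ereal (a 0 x)" using elim(2) by (metis ereal_minus_le_minus uminus_ereal.simps(1))
      finally show ?case by simp
    qed
  next
    case False
    then obtain m where "L m < 0" by (auto simp: not_le)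
    then have "\<not> ereal \<bar>y\<bar> \<le> L m" for y
      by (metis abs_ge_zero ereal_less_eq(5) leD order_trans)
    then show ?thesis using L[of m] by (auto elim: eventually_mono)
  qed
qed

section \<open>Mass and energy forms as integrals over the domain\<close>

lemma transpose_mass_matrix: "transpose (mass_matrix D \<phi>) = mass_matrix D \<phi>"
  by (simp add: vec_eq_iff transpose_def mass_matrix_def mult.commute)

lemma fe_basis_L2_on: "fe_basis D \<phi> \<Longrightarrow> L2_on D (\<phi> i)"
  by (auto simp: fe_basis_def H10_def has_weak_grad_def)

lemma fe_basis_L2_on_weak_grad: "fe_basis D \<phi> \<Longrightarrow> L2_on D (weak_grad D (\<phi> i))"
  by (auto simp: fe_basis_def H10_def has_weak_grad_def)

lemma fe_basis_field_value_zero: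
  assumes "fe_basis D \<phi>" "AE x in lebesgue_on D. field_value \<phi> v x = 0"
  shows "v = 0"
proof -
  have "v $ (p, i) = 0" for p i
  proof -
    have "AE x in lebesgue_on D. (\<Sum>i\<in>UNIV. v $ (p, i) * \<phi> i x) = 0"
      using assms(2) by (rule eventually_mono) (simp add: field_value_def vec_eq_iff)
    then show ?thesis using assms(1)[unfolded fe_basis_def, THEN conjunct2, rule_format, of "\<lambda>i. v $ (p, i)"]
      by blast
  qed
  then show ?thesis by (simp add: vec_eq_iff split_paired_all)
qed

lemma mass_form_integral:
  fixes v w :: "real^('p::finite \<times> 'n::finite)"
  assumes "fe_basis D \<phi>"
  shows "v \<bullet> (M_hat (mass_matrix D \<phi>) *v w) = (LINT x|lebesgue_on D. field_value \<phi> v x \<bullet> field_value \<phi> w x)"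
    and "integrable (lebesgue_on D) (\<lambda>x. field_value \<phi> v x \<bullet> field_value \<phi> w x)"
proof -
  have "integrable (lebesgue_on D) (\<lambda>x. 1 * (\<phi> i x * \<phi> j x))" for i j
    using L2_on_integrable_mult[OF fe_basis_L2_on fe_basis_L2_on] assms by simp
  note * = kron_form_integral[where a = "\<lambda>_. 1" and \<mu> = "lebesgue_on D" and h = \<phi>
      and v = v and w = w and X = "mat 1" and Y = "mass_matrix D \<phi>", OF this]
  show "v \<bullet> (M_hat (mass_matrix D \<phi>) *v w) = (LINT x|lebesgue_on D. field_value \<phi> v x \<bullet> field_value \<phi> w x)"
    "integrable (lebesgue_on D) (\<lambda>x. field_value \<phi> v x \<bullet> field_value \<phi> w x)"
    using * by (simp_all add: M_hat_def mass_matrix_def)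
qed

text \<open>The mass form is the squared L2 norm of the represented field, which vanishes almost
  everywhere only for zero coefficients, by linear independence of the basis.\<close>

lemma mass_form_pos:
  fixes v :: "real^('p::finite \<times> 'n::finite)"
  assumes "fe_basis D \<phi>" "v \<noteq> 0"
  shows "v \<bullet> (M_hat (mass_matrix D \<phi>) *v v) > 0"
proof -
  note int = mass_form_integral[OF assms(1), of v v]
  have "v \<bullet> (M_hat (mass_matrix D \<phi>) *v v) \<noteq> 0"
  proof
    assume "v \<bullet> (M_hat (mass_matrix D \<phi>) *v v) = 0"
    then have "AE x in lebesgue_on D. field_value \<phi> v x \<bullet> field_value \<phi> v x = 0"
      unfolding int(1) by (subst (asm) integral_nonneg_eq_0_iff_AE[OF int(2)]) auto
    then have "v = 0" by (intro fe_basis_field_value_zero[OF assms(1)]) simp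
    then show False using assms(2) by simp
  qed
  moreover have "v \<bullet> (M_hat (mass_matrix D \<phi>) *v v) \<ge> 0"
    unfolding int(1) by simp
  ultimately show ?thesis by simp
qed

text \<open>The matrix acts on the values of the field at each point, so the Euclidean operator norm
  of X carries over to the mass norm with constant 1. This is the source of the factor
  1/\<open>\<phi>min\<close>.\<close>

lemma M_norm_kron_mat1_le:
  fixes v :: "real^('p::finite \<times> 'n::finite)"
  assumes "fe_basis D \<phi>"
  shows "M_norm (mass_matrix D \<phi>) ((X \<otimes>\<^sub>K mat 1) *v v) \<le> onorm ((*v) X) * M_norm (mass_matrix D \<phi>) v"
proof -
  note int = mass_form_integral[OF assms]
  have X: "0 \<le> onorm ((*v) X)" by (simp add: onorm_pos_le matrix_vector_mul_bounded_linear)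
  have "(X *v y) \<bullet> (X *v y) \<le> (onorm ((*v) X))\<^sup>2 * (y \<bullet> y)" for y
  proof -
    have "norm (X *v y) \<le> onorm ((*v) X) * norm y" by (simp add: onorm matrix_vector_mul_bounded_linear)
    then have "(norm (X *v y))\<^sup>2 \<le> (onorm ((*v) X) * norm y)\<^sup>2" by (intro power_mono) auto
    then show ?thesis by (simp add: power_mult_distrib power2_norm_eq_inner)
  qed
  then have "((X \<otimes>\<^sub>K mat 1) *v v) \<bullet> (M_hat (mass_matrix D \<phi>) *v ((X \<otimes>\<^sub>K mat 1) *v v)) \<le>
      (onorm ((*v) X))\<^sup>2 * (v \<bullet> (M_hat (mass_matrix D \<phi>) *v v))"
    unfolding int(1) integral_mult_right_zero[symmetric]
    by (intro integral_mono int(2) Bochner_Integration.integrable_mult_right)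
       (simp add: field_value_kron_mat1)
  then have "M_norm (mass_matrix D \<phi>) ((X \<otimes>\<^sub>K mat 1) *v v) \<le>
      sqrt ((onorm ((*v) X))\<^sup>2 * (v \<bullet> (M_hat (mass_matrix D \<phi>) *v v)))"
    unfolding M_norm_eq by (rule real_sqrt_le_mono)
  then show ?thesis using X by (simp add: M_norm_eq real_sqrt_mult)
qed

text \<open>For X = I this is the squared Frobenius norm of the gradient of the field represented by
  v. The sum over directions reduces gradients to the scalar families that
  \<open>field_value\<close> accepts.\<close>

definition energy_density :: "'a::euclidean_space set \<Rightarrow> ('n::finite \<Rightarrow> 'a \<Rightarrow> real)
    \<Rightarrow> real^'p::finite^'p \<Rightarrow> real^('p \<times> 'n) \<Rightarrow> 'a \<Rightarrow> real" where
  "energy_density D \<phi> X v x = (\<Sum>b\<in>Basis.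
     field_value (\<lambda>i x. weak_grad D (\<phi> i) x \<bullet> b) v x \<bullet>
     (X *v field_value (\<lambda>i x. weak_grad D (\<phi> i) x \<bullet> b) v x))"

lemma stiffness_form_integral:
  fixes v :: "real^('p::finite \<times> 'n::finite)"
  assumes "fe_basis D \<phi>" "Linfty_on D a"
  shows "v \<bullet> ((X \<otimes>\<^sub>K stiffness_matrix D \<phi> a) *v v) = (LINT x|lebesgue_on D. a x * energy_density D \<phi> X v x)"
    and "integrable (lebesgue_on D) (\<lambda>x. a x * energy_density D \<phi> X v x)"
proof -
  define h where "h b i x = weak_grad D (\<phi> i) x \<bullet> b" for b i x
  \<comment> \<open>The inner product of gradients splits over coordinate directions, which makes
    the stiffness matrix a sum of weighted Gram matrices \<open>Y b\<close>, each within the scope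
    of \<open>kron_form_integral\<close>.\<close>
  define Y :: "'a \<Rightarrow> real^'n^'n" where "Y b = (\<chi> i j. LINT x|lebesgue_on D. a x * (h b i x * h b j x))" for b
  have int: "integrable (lebesgue_on D) (\<lambda>x. a x * (h b i x * h b j x))" for b i j
    unfolding h_def using assms
    by (intro Linfty_on_integrable_mult L2_on_integrable_mult L2_on_inner fe_basis_L2_on_weak_grad)
  have "stiffness_matrix D \<phi> a = (\<Sum>b\<in>Basis. Y b)"
    using int
    by (simp add: vec_eq_iff stiffness_matrix_def Y_def euclidean_inner[of "weak_grad D _ _" "weak_grad D _ _"] h_def sum_distrib_left)
  moreover have Yb: "Y b $ i $ j = (LINT x|lebesgue_on D. a x * (h b i x * h b j x))" for b i j
    by (simp add: Y_def)
  have eq: "energy_density D \<phi> X v x = (\<Sum>b\<in>Basis. field_value (h b) v x \<bullet> (X *v field_value (h b) v x))" for x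
    by (simp add: energy_density_def h_def[abs_def])
  note * = kron_form_integral[OF int Yb]
  show "integrable (lebesgue_on D) (\<lambda>x. a x * energy_density D \<phi> X v x)"
    unfolding eq sum_distrib_left by (intro Bochner_Integration.integrable_sum *)
  show "v \<bullet> ((X \<otimes>\<^sub>K stiffness_matrix D \<phi> a) *v v) = (LINT x|lebesgue_on D. a x * energy_density D \<phi> X v x)"
    unfolding \<open>stiffness_matrix D \<phi> a = _\<close> eq kron_sum_right sum_matrix_vector_mult inner_sum_right sum_distrib_left
    by (subst Bochner_Integration.integral_sum) (auto intro: * simp: *(1))
qed

text \<open>For v in the kernel the energy has integral zero, while its integrand is nonnegative
  almost everywhere by coefficient dominance. Hence the gradient of the field vanishes, and with it
  the field and v.\<close>

lemma K_hat_invertible: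
  fixes D :: "'a::euclidean_space set" and \<phi> :: "'n::finite \<Rightarrow> 'a \<Rightarrow> real" and A :: "'p::finite \<Rightarrow> nat \<Rightarrow> nat"
  assumes D: "open D" "bounded D"
    and coeffs: "\<And>m. Linfty_on D (a m)"
      "(\<Sum>m. Linfty_norm D (a (Suc m))) < ess_inf_on D (a 0)"
    and basis: "fe_basis D \<phi>"
    and indices: "\<And>p. multi_index (A p)" "inj A"
  shows "invertible (K_hat A (\<lambda>m. stiffness_matrix D \<phi> (a m)))"
proof (rule invertible_if_trivial_kernel)
  fix v :: "real^('p \<times> 'n)"
  assume "K_hat A (\<lambda>m. stiffness_matrix D \<phi> (a m)) *v v = 0"
  then have "0 = v \<bullet> (K_hat A (\<lambda>m. stiffness_matrix D \<phi> (a m)) *v v)" by simp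
  define e where "e = energy_density D \<phi> (mat 1) v"
  define f where "f x = (\<Sum>m\<le>max_active A. a m x * energy_density D \<phi> (G_moment A m) v x)" for x
  note int = stiffness_form_integral[OF basis coeffs(1)]
  have f_int: "integrable (lebesgue_on D) f"
    unfolding f_def by (intro Bochner_Integration.integrable_sum int)
  have f_0: "(LINT x|lebesgue_on D. f x) = 0"
  proof -
    have "0 = v \<bullet> (K_hat A (\<lambda>m. stiffness_matrix D \<phi> (a m)) *v v)" by fact
    also have "\<dots> = (\<Sum>m\<le>max_active A. LINT x|lebesgue_on D. a m x * energy_density D \<phi> (G_moment A m) v x)"
      unfolding K_hat_def sum_matrix_vector_mult inner_sum_right by (simp add: int)
    also have "\<dots> = (LINT x|lebesgue_on D. f x)"
      unfolding f_def by (intro Bochner_Integration.integral_sum[symmetric] int)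
    finally show ?thesis by simp
  qed
  have density: "\<bar>energy_density D \<phi> (G_moment A m) v x\<bar> \<le> e x" for m x
    unfolding energy_density_def e_def
    by (intro sum_abs[THEN order_trans] sum_mono)
       (use G_moment_quadratic_form_bound[OF indices] in \<open>simp add: power2_norm_eq_inner\<close>)
  then have e_nonneg: "e x \<ge> 0" for x by (meson abs_ge_zero order_trans)
  have dom: "AE x in lebesgue_on D. (\<Sum>m<max_active A. \<bar>a (Suc m) x\<bar>) < a 0 x"
    using coeffs(2) by (rule AE_coefficient_dominance)
  \<comment> \<open>The term m = 0 contributes \<open>a 0 x * e x\<close> exactly, because
    \<open>G_moment A 0\<close> is the identity. Each later term is at least -|a_m| e, and the shift
    by \<open>Suc\<close> runs through m = 1, ..., \<open>max_active A\<close>.\<close>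
  have lower: "(a 0 x - (\<Sum>m<max_active A. \<bar>a (Suc m) x\<bar>)) * e x \<le> f x" for x
  proof -
    have "- (\<bar>a (Suc m) x\<bar> * e x) \<le> a (Suc m) x * energy_density D \<phi> (G_moment A (Suc m)) v x" for m
      using mult_left_mono[OF density[of "Suc m" x], of "\<bar>a (Suc m) x\<bar>"] by (simp add: abs_mult[symmetric])
    then have "(\<Sum>m<max_active A. - (\<bar>a (Suc m) x\<bar> * e x)) \<le>
        (\<Sum>m<max_active A. a (Suc m) x * energy_density D \<phi> (G_moment A (Suc m)) v x)"
      by (rule sum_mono)
    then show ?thesis
      unfolding f_def sum.atMost_shift
      by (simp add: G_moment_def[of A 0] e_def sum_negf algebra_simps sum_distrib_left sum_distrib_right)
  qed
  have "AE x in lebesgue_on D. 0 \<le> f x"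
    using dom
  proof eventually_elim
    case (elim x)
    then have "0 \<le> (a 0 x - (\<Sum>m<max_active A. \<bar>a (Suc m) x\<bar>)) * e x"
      using e_nonneg by simp
    then show ?case using lower by (rule order_trans)
  qed
  then have "AE x in lebesgue_on D. f x = 0"
    using integral_nonneg_eq_0_iff_AE[OF f_int] f_0 by simp
  then have e0: "AE x in lebesgue_on D. e x = 0"
    using dom
  proof eventually_elim
    case (elim x)
    then have "(a 0 x - (\<Sum>m<max_active A. \<bar>a (Suc m) x\<bar>)) * e x \<le> 0" using lower[of x] by simp
    then show ?case using elim(2) e_nonneg[of x] by (simp add: mult_le_0_iff)
  qed
  \<comment> \<open>A single direction suffices for
    \<open>H10_combination_zero_grad\<close>.\<close>
  obtain b :: 'a where b: "b \<in> Basis" using nonempty_Basis by blast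
  have W0: "AE x in lebesgue_on D. field_value (\<lambda>i x. weak_grad D (\<phi> i) x \<bullet> b) v x = 0"
    using e0
  proof eventually_elim
    case (elim x)
    then show ?case using b by (simp add: e_def energy_density_def sum_nonneg_eq_0_iff)
  qed
  have "AE x in lebesgue_on D. \<forall>p. (\<Sum>i\<in>UNIV. v $ (p, i) * \<phi> i x) = 0"
    unfolding AE_all_countable
  proof
    fix p
    show "AE x in lebesgue_on D. (\<Sum>i\<in>UNIV. v $ (p, i) * \<phi> i x) = 0"
    proof (rule H10_combination_zero_grad[OF D _ b])
      show "\<phi> i \<in> H10 D" for i using basis by (simp add: fe_basis_def)
      show "AE x in lebesgue_on D. (\<Sum>i\<in>UNIV. v $ (p, i) * (weak_grad D (\<phi> i) x \<bullet> b)) = 0"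
        using W0 by (rule eventually_mono) (simp add: field_value_def vec_eq_iff)
    qed
  qed
  then have "AE x in lebesgue_on D. field_value \<phi> v x = 0"
    by (rule eventually_mono) (simp add: field_value_def vec_eq_iff)
  then show "v = 0" by (rule fe_basis_field_value_zero[OF basis])
qed

subsection \<open>Convergence\<close>

lemma transpose_G_triple: "transpose (G_triple A p) = G_triple A p"
  by (simp add: vec_eq_iff transpose_def G_triple_def mult_ac)

lemma G_triple_rotate: "G_triple A p $ q $ r = G_triple A q $ p $ r"
  by (simp add: G_triple_def mult_ac)

text \<open>The triple products are invariant under permutation of their three indices, so the row
  index can become the index of the matrix. This identifies the first term of \<open>F_fun\<close>
  with the bilinear expression \<open>Delta A s *v s\<close>.\<close>

lemma Delta_mult_eq: "(Delta A s *v t) $ p = s \<bullet> (G_triple A p *v t)"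
proof -
  have "(Delta A s *v t) $ p = (\<Sum>q\<in>UNIV. s $ q * (\<Sum>r\<in>UNIV. G_triple A q $ p $ r * t $ r))"
    by (simp add: Delta_def sum_matrix_vector_mult flip: scaleR_matrix_vector_assoc)
       (simp add: matrix_vector_mult_def)
  then show ?thesis by (simp add: inner_vec_def matrix_vector_mult_def G_triple_rotate[of A _ p])
qed

lemma Delta_commute: "Delta A s *v t = Delta A t *v s"
proof -
  have "s \<bullet> (G_triple A p *v t) = t \<bullet> (G_triple A p *v s)" for p
    by (metis dot_lmul_matrix inner_commute transpose_G_triple vector_transpose_matrix)
  then show ?thesis by (simp add: vec_eq_iff Delta_mult_eq)
qed

lemma Delta_add: "Delta A (s + t) = Delta A s + Delta A t"
  by (simp add: Delta_def scaleR_add_left sum.distrib)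

lemma Delta_scaleR: "Delta A (c *\<^sub>R s) = c *\<^sub>R Delta A s"
  by (simp add: Delta_def scaleR_sum_right)

lemma bounded_bilinear_Delta: "bounded_bilinear (\<lambda>s t. Delta A s *v t)"
  unfolding bilinear_conv_bounded_bilinear[symmetric] bilinear_def
  by (auto intro!: linearI simp: Delta_add Delta_scaleR matrix_vector_right_distrib
      matrix_vector_mult_scaleR matrix_vector_mult_add_rdistrib scaleR_matrix_vector_assoc[symmetric])

lemma T_mat_add: "T_mat A (s + t) = T_mat A s + T_mat A t"
  by (simp add: T_mat_def Delta_add kron_def vec_eq_iff algebra_simps)

lemma T_mat_scaleR: "T_mat A (c *\<^sub>R s) = c *\<^sub>R T_mat A s"
  by (simp add: T_mat_def Delta_scaleR kron_def vec_eq_iff)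

lemma bounded_bilinear_T_mat: "bounded_bilinear (\<lambda>s v. T_mat A s *v v)"
  unfolding bilinear_conv_bounded_bilinear[symmetric] bilinear_def
  by (auto intro!: linearI simp: T_mat_add T_mat_scaleR matrix_vector_right_distrib
      matrix_vector_mult_scaleR matrix_vector_mult_add_rdistrib scaleR_matrix_vector_assoc[symmetric])

lemma bounded_bilinear_Fv_fun: "bounded_bilinear (Fv_fun A M)"
  unfolding bilinear_conv_bounded_bilinear[symmetric] bilinear_def
  by (auto intro!: linearI simp: Fv_fun_def vec_eq_iff matrix_vector_right_distrib
      matrix_vector_mult_scaleR inner_add_left inner_add_right)

lemma Fv_fun_commute: "transpose M = M \<Longrightarrow> Fv_fun A M v w = Fv_fun A M w v"
  unfolding Fv_fun_def by (subst kron_form_symmetric[OF transpose_G_triple]) auto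

lemma F_fun_eq: "F_fun A M s v = Delta A s *v s - Fv_fun A M v v"
  by (simp add: F_fun_def Fv_fun_def vec_eq_iff Delta_mult_eq)

text \<open>The explicit Kronecker form of the inverse makes \<open>M_norm_kron_mat1_le\<close>
  applicable to it.\<close>

lemma T_mat_inverse:
  assumes "invertible (Delta A s)"
  shows "invertible (T_mat A s :: real^('p::finite \<times> 'n::finite)^('p \<times> 'n))"
    and "matrix_inv (T_mat A s) *v (v :: real^('p \<times> 'n)) = (matrix_inv (Delta A s) \<otimes>\<^sub>K mat 1) *v v"
proof -
  have inv: "Delta A s ** matrix_inv (Delta A s) = mat 1" "matrix_inv (Delta A s) ** Delta A s = mat 1"
    using matrix_inv_apply[OF assms] by (simp_all add: matrix_eq flip: matrix_vector_mul_assoc)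
  have 1: "(matrix_inv (Delta A s) \<otimes>\<^sub>K mat 1) *v (T_mat A s *v w) = w"
    and 2: "T_mat A s *v ((matrix_inv (Delta A s) \<otimes>\<^sub>K mat 1) *v w) = w"
    for w :: "real^('p \<times> 'n)"
    by (simp_all add: T_mat_def kron_mat1_mult inv kron_mat1_mat1)
  show I: "invertible (T_mat A s :: real^('p \<times> 'n)^('p \<times> 'n))"
    by (rule invertible_if_trivial_kernel) (metis 1 matrix_vector_mult_0_right)
  show "matrix_inv (T_mat A s) *v v = (matrix_inv (Delta A s) \<otimes>\<^sub>K mat 1) *v v"
    using matrix_inv_apply(1)[OF I] 2 by metis
qed

text \<open>The quotient \<open>\<psi>max / \<phi>min\<close> bounds the linearised iteration; the
  quadratic term carries what the linearisation drops. Closeness is required of \<open>s k\<close>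
  as well as of \<open>u k\<close>, since the choice among the roots of the nonlinear system is left
  open. The eigenvalue error is measured by the error of \<open>u (k - 1)\<close>, the iterate from
  which \<open>v k\<close> and then \<open>s k\<close> are computed. The constants are chosen before
  the run, hence uniform in n and k.\<close>

theorem theorem3:
  fixes D :: "'a::euclidean_space set" and r :: nat
    and a :: "nat \<Rightarrow> 'a \<Rightarrow> real"
    and \<phi> :: "'n::finite \<Rightarrow> 'a \<Rightarrow> real"
    and A :: "'p::finite \<Rightarrow> nat \<Rightarrow> nat"
    and K :: "nat \<Rightarrow> real^'n^'n" and M :: "real^'n^'n"
    and uA vhat :: "real^('p \<times> 'n)" and shat \<mu>A :: "real^'p"
    and \<phi>min \<psi>max :: real
  assumes domain: "open D" "bounded D" "convex D" "D \<noteq> {}" "r \<ge> 1" "Ck_boundary r D"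
    and coeffs: "\<And>m. Linfty_on D (a m)"
      "(\<Sum>m. Linfty_norm D (a (Suc m))) < ess_inf_on D (a 0)"
    and basis: "fe_basis D \<phi>"
    and indices: "\<And>p. multi_index (A p)" "inj A"
  defines "K \<equiv> \<lambda>m. stiffness_matrix D \<phi> (a m)"
    and "M \<equiv> mass_matrix D \<phi>"
  assumes fixed_point: "uA = S_mat A K M *v vhat"
      "vhat = T_mat A shat *v (S_mat A K M *v vhat)"
      "F_fun A M shat vhat = 0"
    and invertible_Delta: "invertible (Delta A shat)"
  defines "\<mu>A \<equiv> matrix_inv (Delta A shat) *v e1_vec A"
    and "\<phi>min \<equiv> inverse (onorm ((*v) (matrix_inv (Delta A shat))))"
    and "\<psi>max \<equiv> M_onorm M (\<lambda>w. R_op A M shat vhat (matrix_inv (S_mat A K M) *v w))"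
  shows "(\<exists>\<delta>>0. \<exists>c\<ge>0. \<forall>n u v s. spectral_inverse_iteration A K M n u v s \<longrightarrow>
            (\<forall>k\<in>{1..n}. M_norm M (u k - uA) < \<delta> \<and> norm (s k - shat) < \<delta> \<longrightarrow>
               M_norm M (u k - uA) \<le> \<psi>max / \<phi>min * M_norm M (u (k - 1) - uA)
                                      + c * (M_norm M (u (k - 1) - uA))\<^sup>2))
       \<and> (\<exists>\<delta>>0. \<exists>C>0. \<forall>n u v s \<mu>. spectral_inverse_iteration A K M n u v s \<longrightarrow>
            (\<forall>k\<in>{1..n}. M_norm M (u k - uA) < \<delta> \<and> norm (s k - shat) < \<delta> \<longrightarrow>
               Delta A (s k) *v \<mu> k = e1_vec A \<longrightarrow>
               norm (\<mu> k - \<mu>A) \<le> C * M_norm M (u (k - 1) - uA)))"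
proof -
  note M_sym = transpose_mass_matrix[of D \<phi>, folded M_def]
  have M_pos: "v \<bullet> (M_hat M *v v) > 0" if "v \<noteq> 0" for v :: "real^('p \<times> 'n)"
    unfolding M_def using basis that by (rule mass_form_pos)
  define S where "S = S_mat A K M"
  define Di where "Di = matrix_inv (Delta A shat)"
  define Ti :: "real^('p \<times> 'n) \<Rightarrow> real^('p \<times> 'n)" where "Ti v = matrix_inv (T_mat A shat) *v v" for v
  define R where "R = R_op A M shat vhat"
  define Rs where "Rs w = R (matrix_inv S *v w)" for w
  have K_inv: "invertible (K_hat A K)"
    unfolding K_def by (rule K_hat_invertible) (use domain coeffs basis indices in auto)
  have M_inv: "invertible (M_hat M :: real^('p \<times> 'n)^('p \<times> 'n))"
    by (rule M_hat_invertible[OF M_sym M_pos])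
  have S_apply: "S *v v = matrix_inv (M_hat M) *v (K_hat A K *v v)" for v
    by (simp add: S_def S_mat_def matrix_vector_mul_assoc)
  have S_inv: "invertible S"
    by (rule invertible_if_trivial_kernel)
       (metis S_apply matrix_inv_apply K_inv M_inv matrix_vector_mult_0_right)
  have T_fix: "T_mat A shat *v uA = vhat" using fixed_point(1,2) by simp
  have Ti_T: "Ti (T_mat A shat *v w) = w" for w
    unfolding Ti_def by (rule matrix_inv_apply(1)[OF T_mat_inverse(1)[OF invertible_Delta]])
  have Ti_bound: "M_norm M (Ti w) \<le> inverse \<phi>min * M_norm M w" for w
    unfolding Ti_def T_mat_inverse(2)[OF invertible_Delta] \<phi>min_def M_def
    using M_norm_kron_mat1_le[OF basis] by simp
  interpret Fv: bounded_bilinear "Fv_fun A M" by (rule bounded_bilinear_Fv_fun)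
  interpret T: bounded_bilinear "\<lambda>s v. T_mat A s *v (v :: real^('p \<times> 'n))" by (rule bounded_bilinear_T_mat)
  \<comment> \<open>At the fixed point the inverse of T maps \<open>vhat\<close> to
    \<open>uA\<close>, so R becomes exactly the linear expression in the abstract estimate.\<close>
  have R_eq: "R w = w - T_mat A (Di *v Fv_fun A M vhat w) *v uA" for w
    using Ti_T[of uA] by (simp add: R_def R_op_def Di_def Ti_def T_fix)
  have "linear Rs"
    by (rule linearI)
       (simp_all add: Rs_def R_eq matrix_vector_right_distrib matrix_vector_mult_scaleR
         Fv.add_right Fv.scaleR_right T.add_left T.scaleR_left algebra_simps)
  then have Rs_bound: "M_norm M (Rs w) \<le> \<psi>max * M_norm M w" for w
    using M_onorm_bound[OF M_sym M_pos, of Rs w] by (simp add: \<psi>max_def Rs_def[abs_def] R_def S_def)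
  have "\<exists>\<delta>>0. \<exists>C>0. \<forall>s v u. norm (s - shat) < \<delta> \<and> norm (u - uA) < \<delta> \<and>
      Delta A s *v s = Fv_fun A M v v \<and> T_mat A s *v u = v \<longrightarrow>
    norm (s - shat) \<le> C * norm (v - vhat) \<and>
    norm (u - uA - Ti (v - vhat - T_mat A (Di *v (Fv_fun A M vhat (v - vhat))) *v uA)) \<le> C * (norm (v - vhat))\<^sup>2"
  proof (rule bilinear_iteration_local_bound[where Dl = "\<lambda>s t. Delta A s *v t"
        and T = "\<lambda>s v. T_mat A s *v v" and B = "Fv_fun A M" and Di = "\<lambda>s. Di *v s" and Ti = Ti])
    show "Delta A s *v t = Delta A t *v s" for s t by (rule Delta_commute)
    show "Fv_fun A M v w = Fv_fun A M w v" for v w by (rule Fv_fun_commute[OF M_sym])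
    show "Di *v (Delta A shat *v s) = s" for s unfolding Di_def by (rule matrix_inv_apply(1)[OF invertible_Delta])
    show "Delta A shat *v shat = Fv_fun A M vhat vhat" using fixed_point(3) by (simp add: F_fun_eq)
    show "bounded_linear Ti" unfolding Ti_def by (rule matrix_vector_mul_bounded_linear)
  qed (rule bounded_bilinear_Delta bounded_bilinear_T_mat bounded_bilinear_Fv_fun
      matrix_vector_mul_bounded_linear Ti_T T_fix)+
  then obtain \<delta>1 C1 where d1: "\<delta>1 > 0" "C1 > 0" and
    b1: "\<And>s v u. \<lbrakk>norm (s - shat) < \<delta>1; norm (u - uA) < \<delta>1; Delta A s *v s = Fv_fun A M v v;
        T_mat A s *v u = v\<rbrakk> \<Longrightarrow>
      norm (s - shat) \<le> C1 * norm (v - vhat) \<and> norm (u - uA - Ti (R (v - vhat))) \<le> C1 * (norm (v - vhat))\<^sup>2"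
    unfolding R_eq by meson
  obtain cl where cl: "cl > 0" "\<And>w :: real^('p \<times> 'n). cl * norm w \<le> M_norm M w"
    by (rule M_norm_equiv_norm[OF M_sym M_pos]) (assumption, rule that)
  obtain cu where cu: "cu > 0" "\<And>w :: real^('p \<times> 'n). M_norm M w \<le> cu * norm w"
    by (rule M_norm_le_norm[OF M_sym M_pos]) (assumption, rule that)
  have M0: "M_norm M w \<ge> 0" for w :: "real^('p \<times> 'n)"
    using cl(1) cl(2)[of w] by (meson mult_nonneg_nonneg less_imp_le norm_ge_zero order_trans)
  obtain cS where cS: "cS > 0" "\<And>w. norm (matrix_inv S *v w) \<le> norm w * cS"
    using bounded_linear.pos_bounded[OF matrix_vector_mul_bounded_linear[of "matrix_inv S"]] by auto
  \<comment> \<open>The deviation of \<open>v k\<close> is the inverse of S applied to the previous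
    error, so its Euclidean norm is at most \<open>cS / cl\<close> times the mass norm of that
    error. The radius \<open>cl * \<delta>1\<close> turns closeness in the mass norm into Euclidean
    closeness.\<close>
  have step: "norm (s k - shat) \<le> C1 * (cS / cl * M_norm M (u (k - 1) - uA)) \<and>
      norm (u k - uA - Ti (Rs (u (k - 1) - uA))) \<le> C1 * (cS / cl * M_norm M (u (k - 1) - uA))\<^sup>2"
    if it: "spectral_inverse_iteration A K M n u v s" and k: "k \<in> {1..n}"
      and near: "M_norm M (u k - uA) < cl * \<delta>1" "norm (s k - shat) < \<delta>1" for n u v s k
  proof -
    have eqs: "K_hat A K *v v k = M_hat M *v u (k - 1)" "F_fun A M (s k) (v k) = 0" "T_mat A (s k) *v u k = v k"
      using it k by (auto simp: spectral_inverse_iteration_def)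
    have "S *v v k = u (k - 1)" by (simp add: S_apply eqs(1) matrix_inv_apply M_inv)
    then have w: "v k - vhat = matrix_inv S *v (u (k - 1) - uA)"
      using matrix_inv_apply(1)[OF S_inv] fixed_point(1) by (metis S_def matrix_vector_mult_diff_distrib)
    have "cl * norm (u k - uA) < cl * \<delta>1" using cl(2)[of "u k - uA"] near(1) by linarith
    then have "norm (u k - uA) < \<delta>1" using cl(1) by simp
    note b = b1[OF near(2) this _ eqs(3)]
    have "norm (v k - vhat) \<le> cS / cl * M_norm M (u (k - 1) - uA)"
    proof -
      have "norm (v k - vhat) \<le> norm (u (k - 1) - uA) * cS" unfolding w by (rule cS)
      also have "\<dots> \<le> M_norm M (u (k - 1) - uA) / cl * cS"
        using cl(1) cl(2)[of "u (k - 1) - uA"] cS(1) by (intro mult_right_mono) (auto simp: field_simps)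
      finally show ?thesis by (simp add: mult_ac)
    qed
    moreover have "norm (s k - shat) \<le> C1 * norm (v k - vhat)"
      "norm (u k - uA - Ti (Rs (u (k - 1) - uA))) \<le> C1 * (norm (v k - vhat))\<^sup>2"
      using b eqs(2) by (auto simp: F_fun_eq Rs_def w)
    ultimately show ?thesis using d1(2)
      by (meson mult_left_mono less_imp_le norm_ge_zero order_trans power_mono)
  qed
  \<comment> \<open>The linear part \<open>Ti (Rs e)\<close> is estimated directly in the mass norm,
    which keeps its factor equal to \<open>\<psi>max / \<phi>min\<close>. Only the quadratic
    remainder passes through the norm comparison, at the cost of constants.\<close>
  have part1: "M_norm M (u k - uA) \<le> \<psi>max / \<phi>min * M_norm M (u (k - 1) - uA)
      + cu * C1 * (cS / cl)\<^sup>2 * (M_norm M (u (k - 1) - uA))\<^sup>2"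
    if "spectral_inverse_iteration A K M n u v s" "k \<in> {1..n}"
      "M_norm M (u k - uA) < cl * \<delta>1" "norm (s k - shat) < \<delta>1" for n u v s k
  proof -
    define e where "e = u (k - 1) - uA"
    have "M_norm M (u k - uA) \<le> M_norm M (Ti (Rs e)) + M_norm M (u k - uA - Ti (Rs e))"
      using M_norm_triangle[OF M_sym M_pos, of "Ti (Rs e)" "u k - uA - Ti (Rs e)"] by simp
    also have "M_norm M (Ti (Rs e)) \<le> inverse \<phi>min * (\<psi>max * M_norm M e)"
      using Ti_bound[of "Rs e"] Rs_bound[of e]
      by (rule order_trans[OF _ mult_left_mono])
         (simp add: \<phi>min_def onorm_pos_le matrix_vector_mul_bounded_linear)
    also have "M_norm M (u k - uA - Ti (Rs e)) \<le> cu * (C1 * (cS / cl * M_norm M e)\<^sup>2)"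
      using cu(2)[of "u k - uA - Ti (Rs e)"] step[OF that] cu(1)
      unfolding e_def by (meson mult_left_mono less_imp_le order_trans)
    finally show ?thesis by (simp add: e_def power_mult_distrib divide_inverse mult_ac)
  qed
  have "\<exists>\<delta>>0. \<exists>C>0. \<forall>s \<mu>. norm (s - shat) < \<delta> \<and> Delta A s *v \<mu> = Delta A shat *v \<mu>A \<longrightarrow>
      norm (\<mu> - \<mu>A) \<le> C * norm (s - shat)"
    by (rule bilinear_solution_Lipschitz[OF bounded_bilinear_Delta matrix_vector_mul_bounded_linear
        matrix_inv_apply(1)[OF invertible_Delta]])
  then obtain \<delta>2 C2 where d2: "\<delta>2 > 0" "C2 > 0" and
    b2: "\<And>s \<mu>. norm (s - shat) < \<delta>2 \<Longrightarrow> Delta A s *v \<mu> = Delta A shat *v \<mu>A \<Longrightarrow>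
      norm (\<mu> - \<mu>A) \<le> C2 * norm (s - shat)"
    by meson
  \<comment> \<open>\<open>\<mu>A\<close> solves the unperturbed system with right-hand side
    \<open>e1_vec A\<close>, so the Lipschitz bound in s combines with the bound of
    \<open>s k - shat\<close> from \<open>step\<close>.\<close>
  have part2: "norm (\<mu> k - \<mu>A) \<le> C2 * C1 * cS / cl * M_norm M (u (k - 1) - uA)"
    if it: "spectral_inverse_iteration A K M n u v s" "k \<in> {1..n}"
      "M_norm M (u k - uA) < cl * \<delta>1" "norm (s k - shat) < \<delta>1"
      and s2: "norm (s k - shat) < \<delta>2" and \<mu>: "Delta A (s k) *v \<mu> k = e1_vec A"
    for n k and u v :: "nat \<Rightarrow> real^('p \<times> 'n)" and s \<mu>
  proof -
    have "norm (\<mu> k - \<mu>A) \<le> C2 * norm (s k - shat)"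
      using s2 \<mu> by (intro b2) (simp_all add: \<mu>A_def matrix_inv_apply invertible_Delta)
    also have "\<dots> \<le> C2 * (C1 * (cS / cl * M_norm M (u (k - 1) - uA)))"
      using step[OF it] d2(2) by (intro mult_left_mono) auto
    finally show ?thesis by (simp add: mult_ac)
  qed
  have "\<exists>\<delta>>0. \<exists>c\<ge>0. \<forall>n u v s. spectral_inverse_iteration A K M n u v s \<longrightarrow>
            (\<forall>k\<in>{1..n}. M_norm M (u k - uA) < \<delta> \<and> norm (s k - shat) < \<delta> \<longrightarrow>
               M_norm M (u k - uA) \<le> \<psi>max / \<phi>min * M_norm M (u (k - 1) - uA)
                                      + c * (M_norm M (u (k - 1) - uA))\<^sup>2)"
  proof (intro exI conjI allI impI ballI)
    \<comment> \<open>One radius has to serve for the mass norm of the error of u and for the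
      Euclidean norm of the error of s.\<close>
    show "min (cl * \<delta>1) \<delta>1 > 0" using d1 cl(1) by simp
    show "cu * C1 * (cS / cl)\<^sup>2 \<ge> 0" using d1 cu(1) by simp
  qed (rule part1, assumption, assumption, auto)
  moreover have "\<exists>\<delta>>0. \<exists>C>0. \<forall>n u v s \<mu>. spectral_inverse_iteration A K M n u v s \<longrightarrow>
            (\<forall>k\<in>{1..n}. M_norm M (u k - uA) < \<delta> \<and> norm (s k - shat) < \<delta> \<longrightarrow>
               Delta A (s k) *v \<mu> k = e1_vec A \<longrightarrow>
               norm (\<mu> k - \<mu>A) \<le> C * M_norm M (u (k - 1) - uA))"
  proof (intro exI conjI allI impI ballI)
    show "min (min (cl * \<delta>1) \<delta>1) \<delta>2 > 0" using d1 d2 cl(1) by simp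
    show "C2 * C1 * cS / cl > 0" using d1 d2 cl(1) cS(1) by simp
  qed (rule part2, assumption, assumption, auto)
  ultimately show ?thesis by blast
qed

end
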